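(* The Maximum Matching Edge Interdiction problem (MMEI), restricted to instances in which all edge weights equal $1$, is fixed-parameter tractable when parameterized by the combined parameter $b+m$.
   Context: For an edge-weighted graph $G$, $\nu(G)$ denotes the maximum total weight of a matching in $G$. For $I\subseteq E$, $G-I$ is the graph obtained by deleting the edges of $I$, and $c(I)=\sum_{e\in I}c(e)$. MMEI: given an undirected graph $G=(V,E)$ with weight function $w:E\to\mathbb{Z}_{\ge 0}$, interdiction cost function $c:E\to\mathbb{Z}_{\ge 1}$, and positive integers $b$ and $m$, decide whether there is a set $I\subseteq E$ with $c(I)\le b$ such that $\nu(G-I)\le m$. *)

theory Defs
  imports Main "HOL-Library.Disjoint_Sets"
begin

section \<open>Model of computation\<close>

text \<open>
  The machine model is the WHILE language over binary trees of N. D. Jones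
  (Computability and Complexity from a Programming Perspective, MIT Press 1997), without a
  built-in tree comparison. Trees are built from one atom by pairing, and every elementary
  operation takes one unit of time. A tree that has been built is a pointer structure whose size
  is linear in the time spent, so this time measure is polynomially related to that of Turing
  machines, and the class of fixed-parameter tractable problems is the usual one.
\<close>

datatype bt = Leaf | Br (left: bt) (right: bt)
where
  "left Leaf = Leaf"
| "right Leaf = Leaf"

primrec nodes :: "bt \<Rightarrow> nat" where
  "nodes Leaf = 1"
| "nodes (Br l r) = 1 + nodes l + nodes r"

datatype expr = Var nat | Nil_expr | Cons_expr expr expr | Hd expr | Tl expr

type_synonym store = "nat \<Rightarrow> bt"

primrec val :: "expr \<Rightarrow> store \<Rightarrow> bt" where
  "val (Var x) s = s x"
| "val Nil_expr s = Leaf"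
| "val (Cons_expr e1 e2) s = Br (val e1 s) (val e2 s)"
| "val (Hd e) s = left (val e s)"
| "val (Tl e) s = right (val e s)"

primrec expr_time :: "expr \<Rightarrow> nat" where
  "expr_time (Var x) = 1"
| "expr_time Nil_expr = 1"
| "expr_time (Cons_expr e1 e2) = 1 + expr_time e1 + expr_time e2"
| "expr_time (Hd e) = 1 + expr_time e"
| "expr_time (Tl e) = 1 + expr_time e"

datatype com =
    Skip
  | Assign nat expr
  | Seq com com
  | If expr com com
  | While expr com

text \<open>
  \<open>exec p s t s'\<close>: started in store \<open>s\<close>, the program \<open>p\<close> halts after \<open>t\<close> time units
  in store \<open>s'\<close>. In tests, every tree other than the atom counts as true.
\<close>

inductive exec :: "com \<Rightarrow> store \<Rightarrow> nat \<Rightarrow> store \<Rightarrow> bool" where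
  Skip: "exec Skip s 1 s"
| Assign: "exec (Assign x e) s (1 + expr_time e) (s(x := val e s))"
| Seq: "exec p1 s t1 s1 \<Longrightarrow> exec p2 s1 t2 s2 \<Longrightarrow> exec (Seq p1 p2) s (t1 + t2) s2"
| IfTrue: "val e s \<noteq> Leaf \<Longrightarrow> exec p1 s t s1 \<Longrightarrow> exec (If e p1 p2) s (1 + expr_time e + t) s1"
| IfFalse: "val e s = Leaf \<Longrightarrow> exec p2 s t s1 \<Longrightarrow> exec (If e p1 p2) s (1 + expr_time e + t) s1"
| WhileFalse: "val e s = Leaf \<Longrightarrow> exec (While e p) s (1 + expr_time e) s"
| WhileTrue: "val e s \<noteq> Leaf \<Longrightarrow> exec p s t1 s1 \<Longrightarrow> exec (While e p) s1 t2 s2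
    \<Longrightarrow> exec (While e p) s (1 + expr_time e + t1 + t2) s2"

inductive_cases exec_SkipE: "exec Skip s t s1"
inductive_cases exec_AssignE: "exec (Assign x e) s t s1"
inductive_cases exec_SeqE: "exec (Seq p1 p2) s t s1"
inductive_cases exec_IfE: "exec (If e p1 p2) s t s1"
inductive_cases exec_WhileE: "exec (While e p) s t s1"

lemma exec_deterministic:
  "exec p s t s1 \<Longrightarrow> exec p s t' s1' \<Longrightarrow> t' = t \<and> s1' = s1"
proof (induction arbitrary: t' s1' rule: exec.induct)
  case (Skip s)
  then show ?case by (auto elim: exec_SkipE)
next
  case (Assign x e s)
  then show ?case by (auto elim: exec_AssignE)
next
  case (Seq p1 s t1 s1 p2 t2 s2)
  from Seq.prems show ?case
  proof (rule exec_SeqE)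
    fix u1 r u2
    assume a: "t' = u1 + u2" "exec p1 s u1 r" "exec p2 r u2 s1'"
    have "u1 = t1 \<and> r = s1" using a(2) by (rule Seq.IH(1))
    then show ?thesis using a(1,3) Seq.IH(2)[of u2 s1'] by simp
  qed
next
  case (IfTrue e s p1 t s1 p2)
  from IfTrue.prems show ?case
  proof (rule exec_IfE)
    fix u
    assume a: "t' = Suc (expr_time e + u)" "exec p1 s u s1'"
    show ?thesis using IfTrue.IH[OF a(2)] a(1) by simp
  qed (use IfTrue.hyps in simp_all)
next
  case (IfFalse e s p2 t s1 p1)
  from IfFalse.prems show ?case
  proof (rule exec_IfE)
    fix u
    assume a: "t' = Suc (expr_time e + u)" "exec p2 s u s1'"
    show ?thesis using IfFalse.IH[OF a(2)] a(1) by simp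
  qed (use IfFalse.hyps in simp_all)
next
  case (WhileFalse e s p)
  from WhileFalse.prems show ?case
    by (rule exec_WhileE) (use WhileFalse.hyps in simp_all)
next
  case (WhileTrue e s p t1 s1 t2 s2)
  from WhileTrue.prems show ?case
  proof (rule exec_WhileE)
    fix u1 r u2
    assume a: "t' = Suc (expr_time e + u1 + u2)" "exec p s u1 r" "exec (While e p) r u2 s1'"
    have "u1 = t1 \<and> r = s1" using a(2) by (rule WhileTrue.IH(1))
    then show ?thesis using a(1,3) WhileTrue.IH(2)[of u2 s1'] by simp
  qed (use WhileTrue.hyps in simp_all)
qed

text \<open>Register \<open>0\<close> holds the input at the start and the result at the end.\<close>

definition init :: "bt \<Rightarrow> store" where
  "init x = (\<lambda>_. Leaf)(0 := x)"

definition outputs :: "com \<Rightarrow> bt \<Rightarrow> nat \<Rightarrow> bt \<Rightarrow> bool" where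
  "outputs p x t y \<longleftrightarrow> (\<exists>s. exec p (init x) t s \<and> s 0 = y)"


section \<open>Encodings\<close>

definition enc_list :: "bt list \<Rightarrow> bt" where
  "enc_list xs = foldr Br xs Leaf"

definition enc_unary :: "nat \<Rightarrow> bt" where
  "enc_unary n = enc_list (replicate n Leaf)"

text \<open>Binary digits, least significant digit first.\<close>

fun bits :: "nat \<Rightarrow> bool list" where
  "bits 0 = []"
| "bits (Suc n) = odd (Suc n) # bits (Suc n div 2)"

definition enc_bool :: "bool \<Rightarrow> bt" where
  "enc_bool a = (if a then Br Leaf Leaf else Leaf)"

definition enc_nat :: "nat \<Rightarrow> bt" where
  "enc_nat n = enc_list (map enc_bool (bits n))"


section \<open>Fixed-parameter tractability\<close>

definition computable :: "(nat \<Rightarrow> nat) \<Rightarrow> bool" where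
  "computable f \<longleftrightarrow> (\<exists>p. \<forall>k. \<exists>t. outputs p (enc_unary k) t (enc_unary (f k)))"

text \<open>
  A parameterized problem consists of a set \<open>D\<close> of instances, a relation \<open>enc x a\<close>
  (\<open>x\<close> is an input representing the instance \<open>a\<close>), the predicate \<open>yes\<close> singling out the
  yes-instances, and the parameter \<open>\<kappa>\<close>. An instance may have several representations, for
  example one for each order in which the edges of a graph are listed; the algorithm has to
  handle all of them. The size of an input is its number of nodes.
\<close>

definition fpt :: "'a set \<Rightarrow> (bt \<Rightarrow> 'a \<Rightarrow> bool) \<Rightarrow> ('a \<Rightarrow> bool) \<Rightarrow> ('a \<Rightarrow> nat) \<Rightarrow> bool" where
  "fpt D enc yes \<kappa> \<longleftrightarrow>
    (\<exists>p f d. computable f \<and>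
      (\<forall>a\<in>D. \<forall>x. enc x a \<longrightarrow>
        (\<exists>t y. outputs p x t y \<and> t \<le> f (\<kappa> a) * nodes x ^ d \<and> (y \<noteq> Leaf \<longleftrightarrow> yes a))))"


section \<open>Maximum matching edge interdiction\<close>

definition matching :: "'v set set \<Rightarrow> 'v set set \<Rightarrow> bool" where
  "matching E M \<longleftrightarrow> M \<subseteq> E \<and> disjoint M"

definition nu :: "'v set set \<Rightarrow> ('v set \<Rightarrow> nat) \<Rightarrow> nat" where
  "nu E w = Max {sum w M | M. matching E M}"

text \<open>
  Edges are two-element sets of vertices. Vertices are natural numbers, which serve as names in
  the input. Only the values of the weight and cost functions on edges are relevant.
\<close>

record mmei =
  verts :: "nat set"
  edges :: "nat set set"
  weight :: "nat set \<Rightarrow> nat"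
  cost :: "nat set \<Rightarrow> nat"
  budget :: nat
  target :: nat

definition mmei_instance :: "mmei \<Rightarrow> bool" where
  "mmei_instance G \<longleftrightarrow>
    finite (verts G) \<and> (\<forall>e\<in>edges G. e \<subseteq> verts G \<and> card e = 2) \<and>
    (\<forall>e\<in>edges G. cost G e \<ge> 1) \<and> budget G \<ge> 1 \<and> target G \<ge> 1"

definition mmei_yes :: "mmei \<Rightarrow> bool" where
  "mmei_yes G \<longleftrightarrow>
    (\<exists>I\<subseteq>edges G. sum (cost G) I \<le> budget G \<and> nu (edges G - I) (weight G) \<le> target G)"

text \<open>
  An instance is presented by a list of its vertices, a list of its edges (each given by its end
  vertices in either order, its weight and its cost), the budget and the target. All numbers are
  written in binary.
\<close>

definition enc_edge :: "mmei \<Rightarrow> nat \<times> nat \<Rightarrow> bt" where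
  "enc_edge G = (\<lambda>(u, v). Br (Br (enc_nat u) (enc_nat v))
     (Br (enc_nat (weight G {u, v})) (enc_nat (cost G {u, v}))))"

definition mmei_enc :: "bt \<Rightarrow> mmei \<Rightarrow> bool" where
  "mmei_enc x G \<longleftrightarrow>
    (\<exists>vs es. distinct vs \<and> set vs = verts G \<and>
      distinct (map (\<lambda>(u, v). {u, v}) es) \<and> set (map (\<lambda>(u, v). {u, v}) es) = edges G \<and>
      x = Br (Br (enc_list (map enc_nat vs)) (enc_list (map (enc_edge G) es)))
             (Br (enc_nat (budget G)) (enc_nat (target G))))"

lemma mmei_enc_exists:
  assumes "mmei_instance G"
  shows "\<exists>x. mmei_enc x G"
proof -
  have fin: "finite (verts G)" and E: "\<forall>e\<in>edges G. e \<subseteq> verts G \<and> card e = 2"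
    using assms by (auto simp: mmei_instance_def)
  have "finite (edges G)"
    using fin E by (intro finite_subset[of "edges G" "Pow (verts G)"]) auto
  then obtain ls where ls: "set ls = edges G" "distinct ls"
    using finite_distinct_list by blast
  obtain vs where vs: "set vs = verts G" "distinct vs"
    using fin finite_distinct_list by blast
  have "\<exists>q. (\<lambda>(u, v). {u, v}) q = e" if e: "e \<in> edges G" for e
  proof -
    have "card e = 2" using E e by blast
    then obtain u v where "e = {u, v}" by (auto simp: card_2_iff)
    then show ?thesis by (intro exI[of _ "(u, v)"]) simp
  qed
  then obtain h where h: "\<And>e. e \<in> edges G \<Longrightarrow> (\<lambda>(u, v). {u, v}) (h e) = e"
    by metis
  define es where "es = map h ls"
  have es: "map (\<lambda>(u, v). {u, v}) es = ls"
    unfolding es_def map_map by (rule map_idI) (use h ls(1) in \<open>simp only: comp_def\<close>)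
  have "distinct vs \<and> set vs = verts G \<and>
      distinct (map (\<lambda>(u, v). {u, v}) es) \<and> set (map (\<lambda>(u, v). {u, v}) es) = edges G"
    unfolding es using ls vs by blast
  then show ?thesis
    unfolding mmei_enc_def by blast
qed

end

theory Submission
  imports Defs
begin

text \<open>
  A bounded search tree. Call a vertex of \<open>G - I\<close> high if its degree is at least \<open>2 m + 2\<close>. If
  \<open>G - I\<close> has no matching with more than \<open>m\<close> edges, then the set \<open>U\<close> of high vertices and the set
  \<open>F\<close> of edges avoiding \<open>U\<close> satisfy \<open>|U| + \<nu>(F) \<le> m\<close>, because any matching of \<open>F\<close> extends greedily
  by an edge at each high vertex; and \<open>|F| \<le> 2 m (2 m + 1)\<close>, because the at most \<open>2 m\<close> vertices of a
  maximal matching of \<open>F\<close> meet all edges of \<open>F\<close> and have small degree. Conversely, if every edge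
  of \<open>G - I\<close> meets \<open>U\<close> or lies in \<open>F\<close>, and \<open>|U| + \<nu>(F) \<le> m\<close>, then \<open>\<nu>(G - I) \<le> m\<close>.

  Hence one may run through the edges and branch on each edge that does not meet the current
  \<open>U\<close>: delete it, put one of its ends into \<open>U\<close>, or put it into \<open>F\<close>. As \<open>b + m + 2 m (2 m + 1)\<close>
  branchings suffice, the number of states is bounded in terms of \<open>b + m\<close>, and so is the number
  of matchings of \<open>F\<close> that have to be enumerated at the end.

  Apart from the doubling that provides lists of the required lengths, all functions involved are
  computable in polynomial time, even on ill-formed input, since every list of states is clipped
  to the length of such a list.
\<close>

section \<open>Programs with time bounds\<close>

definition runs :: "com \<Rightarrow> store \<Rightarrow> nat \<Rightarrow> store \<Rightarrow> bool" where
  "runs p s n s' \<longleftrightarrow> (\<exists>t\<le>n. exec p s t s')"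

lemma runs_mono: "runs p s m s' \<Longrightarrow> m \<le> n \<Longrightarrow> runs p s n s'"
  unfolding runs_def by (meson order_trans)

lemma runs_Skip: "runs Skip s 1 s"
  unfolding runs_def using exec.Skip by blast

lemma runs_Assign: "runs (Assign x e) s (1 + expr_time e) (s(x := val e s))"
  unfolding runs_def using exec.Assign by blast

lemma runs_Seq: "runs p s m s1 \<Longrightarrow> runs q s1 n s2 \<Longrightarrow> runs (Seq p q) s (m + n) s2"
  unfolding runs_def by (meson add_mono exec.Seq)

lemma runs_IfTrue:
  "val e s \<noteq> Leaf \<Longrightarrow> runs p s n s1 \<Longrightarrow> runs (If e p q) s (1 + expr_time e + n) s1"
  unfolding runs_def by (metis add_le_cancel_left exec.IfTrue)

lemma runs_IfFalse:
  "val e s = Leaf \<Longrightarrow> runs q s n s1 \<Longrightarrow> runs (If e p q) s (1 + expr_time e + n) s1"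
  unfolding runs_def by (metis add_le_cancel_left exec.IfFalse)

lemma runs_WhileFalse: "val e s = Leaf \<Longrightarrow> runs (While e p) s (1 + expr_time e) s"
  unfolding runs_def using exec.WhileFalse by blast

lemma runs_WhileTrue:
  assumes "val e s \<noteq> Leaf" "runs p s m s1" "runs (While e p) s1 n s2"
  shows "runs (While e p) s (1 + expr_time e + m + n) s2"
proof -
  obtain t1 t2 where t: "t1 \<le> m" "exec p s t1 s1" "t2 \<le> n" "exec (While e p) s1 t2 s2"
    using assms(2,3) unfolding runs_def by blast
  have "1 + expr_time e + t1 + t2 \<le> 1 + expr_time e + m + n" using t by linarith
  then show ?thesis
    unfolding runs_def using exec.WhileTrue[OF assms(1) t(2,4)] by blast
qed

section \<open>Functions on trees and the register convention of their programs\<close>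

text \<open>Argument and result have separate registers so that an argument can outlive its use: for
  \<open>j < k\<close> register \<open>j\<close> is among those preserved.\<close>

definition comp_at :: "nat \<Rightarrow> nat \<Rightarrow> com \<Rightarrow> (bt \<Rightarrow> bt) \<Rightarrow> (bt \<Rightarrow> nat) \<Rightarrow> bool" where
  "comp_at j k p F T \<longleftrightarrow> (\<forall>s. \<exists>s'. runs p s (T (s j)) s' \<and> s' k = F (s j) \<and> (\<forall>i<k. s' i = s i))"

lemma comp_atI:
  "(\<And>s. \<exists>s'. runs p s (T (s j)) s' \<and> s' k = F (s j) \<and> (\<forall>i<k. s' i = s i)) \<Longrightarrow> comp_at j k p F T"
  unfolding comp_at_def by blast

lemma comp_atE:
  assumes "comp_at j k p F T"
  obtains s' where "runs p s (T (s j)) s'" "s' k = F (s j)" "\<forall>i<k. s' i = s i"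
  using assms unfolding comp_at_def by blast

text \<open>
  The program for register \<open>j\<close> may destroy the registers above \<open>j\<close> but keeps those below, so
  programs for different functions can be combined by giving them different base registers.
\<close>

definition comp_in :: "(bt \<Rightarrow> bt) \<Rightarrow> (bt \<Rightarrow> nat) \<Rightarrow> bool" where
  "comp_in F T \<longleftrightarrow> (\<forall>j. \<exists>p. comp_at j j p F T)"

lemma comp_inE:
  assumes "comp_in F T"
  obtains p where "comp_at j j p F T"
  using assms unfolding comp_in_def by meson

lemma comp_in_mono: "comp_in F T \<Longrightarrow> (\<And>x. T x \<le> T' x) \<Longrightarrow> comp_in F T'"
  unfolding comp_in_def comp_at_def by (meson runs_mono)

lemma comp_in_id: "comp_in (\<lambda>x. x) (\<lambda>x. 1)"
  unfolding comp_in_def comp_at_def using runs_Skip by blast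

lemma comp_in_expr:
  assumes "\<And>j. \<exists>e. expr_time e = n \<and> (\<forall>s. val e s = F (s j))"
  shows "comp_in F (\<lambda>x. Suc n)"
  unfolding comp_in_def
proof
  fix j
  obtain e where e: "expr_time e = n" "\<forall>s. val e s = F (s j)" using assms by meson
  have "comp_at j j (Assign j e) F (\<lambda>x. Suc n)"
  proof (rule comp_atI, intro exI conjI)
    fix s
    show "runs (Assign j e) s (Suc n) (s(j := F (s j)))"
      using runs_Assign[of j e s] e by simp
  qed simp_all
  then show "\<exists>p. comp_at j j p F (\<lambda>x. Suc n)" by blast
qed

lemma comp_in_Leaf: "comp_in (\<lambda>x. Leaf) (\<lambda>x. 2)"
proof -
  have "\<exists>e. expr_time e = 1 \<and> (\<forall>s. val e s = Leaf)" for j :: nat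
    by (rule exI[of _ Nil_expr]) simp
  from comp_in_expr[OF this] show ?thesis by (simp add: numeral_2_eq_2)
qed

lemma comp_in_left: "comp_in left (\<lambda>x. 3)"
proof -
  have "\<exists>e. expr_time e = 2 \<and> (\<forall>s. val e s = left (s j))" for j
    by (rule exI[of _ "Hd (Var j)"]) simp
  from comp_in_expr[OF this] show ?thesis by simp
qed

lemma comp_in_right: "comp_in right (\<lambda>x. 3)"
proof -
  have "\<exists>e. expr_time e = 2 \<and> (\<forall>s. val e s = right (s j))" for j
    by (rule exI[of _ "Tl (Var j)"]) simp
  from comp_in_expr[OF this] show ?thesis by simp
qed

lemma comp_in_compose:
  assumes "comp_in F T" "comp_in G U"
  shows "comp_in (\<lambda>x. G (F x)) (\<lambda>x. T x + U (F x))"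
  unfolding comp_in_def
proof
  fix j
  obtain p where p: "comp_at j j p F T" using assms(1) by (rule comp_inE)
  obtain q where q: "comp_at j j q G U" using assms(2) by (rule comp_inE)
  have "comp_at j j (Seq p q) (\<lambda>x. G (F x)) (\<lambda>x. T x + U (F x))"
  proof (rule comp_atI)
    fix s
    obtain s1 where s1: "runs p s (T (s j)) s1" "s1 j = F (s j)" "\<forall>i<j. s1 i = s i"
      using p by (rule comp_atE)
    obtain s2 where s2: "runs q s1 (U (s1 j)) s2" "s2 j = G (s1 j)" "\<forall>i<j. s2 i = s1 i"
      using q by (rule comp_atE)
    show "\<exists>s'. runs (Seq p q) s (T (s j) + U (F (s j))) s' \<and> s' j = G (F (s j)) \<and> (\<forall>i<j. s' i = s i)"
      using runs_Seq[OF s1(1) s2(1)] s1 s2 by (intro exI[of _ s2]) simp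
  qed
  then show "\<exists>p. comp_at j j p (\<lambda>x. G (F x)) (\<lambda>x. T x + U (F x))" by blast
qed

text \<open>Working on a copy in a higher register keeps the argument available for a second
  function, as pairing and case distinction require.\<close>

lemma comp_in_copy:
  assumes "comp_in F T" "j < k"
  obtains p where "comp_at j k p F (\<lambda>x. 2 + T x)"
proof -
  obtain p where p: "comp_at k k p F T" using assms(1) by (rule comp_inE)
  have "comp_at j k (Seq (Assign k (Var j)) p) F (\<lambda>x. 2 + T x)"
  proof (rule comp_atI)
    fix s :: store
    let ?s = "s(k := s j)"
    obtain s' where s': "runs p ?s (T (?s k)) s'" "s' k = F (?s k)" "\<forall>i<k. s' i = ?s i"
      using p by (rule comp_atE)
    show "\<exists>s'. runs (Seq (Assign k (Var j)) p) s (2 + T (s j)) s' \<and> s' k = F (s j) \<and> (\<forall>i<k. s' i = s i)"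
      using runs_Seq[OF runs_Assign[of k "Var j" s, simplified] s'(1)] s' by (intro exI[of _ s']) simp
  qed
  then show ?thesis by (rule that)
qed

lemma comp_in_Br:
  assumes "comp_in F T" "comp_in G U"
  shows "comp_in (\<lambda>x. Br (F x) (G x)) (\<lambda>x. T x + U x + 8)"
  unfolding comp_in_def
proof
  fix j :: nat
  obtain p where p: "comp_at j (j+1) p F (\<lambda>x. 2 + T x)"
    using comp_in_copy[OF assms(1), of j "j+1"] by auto
  obtain q where q: "comp_at j (j+2) q G (\<lambda>x. 2 + U x)"
    using comp_in_copy[OF assms(2), of j "j+2"] by auto
  let ?p = "Seq p (Seq q (Assign j (Cons_expr (Var (j+1)) (Var (j+2)))))"
  have "comp_at j j ?p (\<lambda>x. Br (F x) (G x)) (\<lambda>x. T x + U x + 8)"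
  proof (rule comp_atI)
    fix s
    obtain s1 where s1: "runs p s (2 + T (s j)) s1" "s1 (j+1) = F (s j)" "\<forall>i<j+1. s1 i = s i"
      using p by (rule comp_atE)
    obtain s2 where s2: "runs q s1 (2 + U (s1 j)) s2" "s2 (j+2) = G (s1 j)" "\<forall>i<j+2. s2 i = s1 i"
      using q by (rule comp_atE)
    \<comment> \<open>Each copy costs 2 and the closing assignment 4, which makes up the 8.\<close>
    have "runs ?p s (T (s j) + U (s j) + 8) (s2(j := Br (s2 (j+1)) (s2 (j+2))))"
      using runs_mono[OF runs_Seq[OF s1(1) runs_Seq[OF s2(1) runs_Assign[of j "Cons_expr (Var (j+1)) (Var (j+2))"]]],
          of "T (s j) + U (s j) + 8"] s1(3)
      by simp
    then show "\<exists>s'. runs ?p s (T (s j) + U (s j) + 8) s' \<and> s' j = Br (F (s j)) (G (s j)) \<and> (\<forall>i<j. s' i = s i)"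
      using s1 s2 by (intro exI[of _ "s2(j := Br (s2 (j+1)) (s2 (j+2)))"]) simp
  qed
  then show "\<exists>p. comp_at j j p (\<lambda>x. Br (F x) (G x)) (\<lambda>x. T x + U x + 8)" by blast
qed

lemma comp_in_if:
  assumes "comp_in C T" "comp_in F U" "comp_in G V"
  shows "comp_in (\<lambda>x. if C x = Leaf then F x else G x) (\<lambda>x. T x + U x + V x + 4)"
  unfolding comp_in_def
proof
  fix j :: nat
  obtain p where p: "comp_at j (j+1) p C (\<lambda>x. 2 + T x)"
    using comp_in_copy[OF assms(1), of j "j+1"] by auto
  obtain q where q: "comp_at j j q F U" using assms(2) by (rule comp_inE)
  obtain r where r: "comp_at j j r G V" using assms(3) by (rule comp_inE)
  let ?p = "Seq p (If (Var (j+1)) r q)"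
  have "comp_at j j ?p (\<lambda>x. if C x = Leaf then F x else G x) (\<lambda>x. T x + U x + V x + 4)"
  proof (rule comp_atI)
    fix s
    obtain s1 where s1: "runs p s (2 + T (s j)) s1" "s1 (j+1) = C (s j)" "\<forall>i<j+1. s1 i = s i"
      using p by (rule comp_atE)
    show "\<exists>s'. runs ?p s (T (s j) + U (s j) + V (s j) + 4) s' \<and>
        s' j = (if C (s j) = Leaf then F (s j) else G (s j)) \<and> (\<forall>i<j. s' i = s i)"
    proof (cases "C (s j) = Leaf")
      case True
      obtain s2 where s2: "runs q s1 (U (s1 j)) s2" "s2 j = F (s1 j)" "\<forall>i<j. s2 i = s1 i"
        using q by (rule comp_atE)
      have t: "val (Var (j+1)) s1 = Leaf" using s1(2) True by simp
      have "runs ?p s (T (s j) + U (s j) + V (s j) + 4) s2"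
        by (rule runs_mono[OF runs_Seq[OF s1(1) runs_IfFalse[OF t s2(1)]]]) (use s1 in simp)
      then show ?thesis using s1 s2 True by (intro exI[of _ s2]) simp
    next
      case False
      obtain s2 where s2: "runs r s1 (V (s1 j)) s2" "s2 j = G (s1 j)" "\<forall>i<j. s2 i = s1 i"
        using r by (rule comp_atE)
      have t: "val (Var (j+1)) s1 \<noteq> Leaf" using s1(2) False by simp
      have "runs ?p s (T (s j) + U (s j) + V (s j) + 4) s2"
        by (rule runs_mono[OF runs_Seq[OF s1(1) runs_IfTrue[OF t s2(1)]]]) (use s1 in simp)
      then show ?thesis using s1 s2 False by (intro exI[of _ s2]) simp
    qed
  qed
  then show "\<exists>p. comp_at j j p (\<lambda>x. if C x = Leaf then F x else G x) (\<lambda>x. T x + U x + V x + 4)" by blast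
qed

section \<open>Iteration along a list\<close>

primrec list_of :: "bt \<Rightarrow> bt list" where
  "list_of Leaf = []"
| "list_of (Br l r) = l # list_of r"

lemma list_of_enc_list [simp]: "list_of (enc_list xs) = xs"
  by (induction xs) (simp_all add: enc_list_def)

lemma enc_list_list_of [simp]: "enc_list (list_of x) = x"
  by (induction x) (simp_all add: enc_list_def)

lemma list_of_right: "list_of (right x) = tl (list_of x)"
  by (cases x) simp_all

text \<open>All loops of the programs arise here. The argument stays in register \<open>j\<close>,
  the rest of the list is in \<open>j+1\<close>, the accumulator in \<open>j+2\<close>, and
  \<open>j+3\<close> receives argument, accumulator and element packed into one tree. The bound
  \<open>B\<close> is asked only for accumulators reached after a prefix of the actual list, since a
  step may be slow on others.\<close>

lemma comp_in_fold:
  assumes L: "comp_in L TL" and A: "comp_in A TA"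
    and step: "comp_in (\<lambda>y. step (left y) (left (right y)) (right (right y))) T"
    and B: "\<And>x ys e zs. list_of (L x) = ys @ e # zs \<Longrightarrow>
      T (Br x (Br (foldl (step x) (A x) ys) e)) \<le> B x"
  shows "comp_in (\<lambda>x. foldl (step x) (A x) (list_of (L x)))
    (\<lambda>x. TL x + TA x + length (list_of (L x)) * (B x + 20) + 20)"
  unfolding comp_in_def
proof
  fix j :: nat
  obtain p where p: "comp_at j (j+1) p L (\<lambda>x. 2 + TL x)"
    using comp_in_copy[OF L, of j "j+1"] by auto
  obtain q where q: "comp_at j (j+2) q A (\<lambda>x. 2 + TA x)"
    using comp_in_copy[OF A, of j "j+2"] by auto
  obtain r where r: "comp_at (j+3) (j+3) r (\<lambda>y. step (left y) (left (right y)) (right (right y))) T"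
    using step by (rule comp_inE)
  define body where "body = Seq (Assign (j+3) (Cons_expr (Var j) (Cons_expr (Var (j+2)) (Hd (Var (j+1))))))
    (Seq r (Seq (Assign (j+2) (Var (j+3))) (Assign (j+1) (Tl (Var (j+1))))))"
  have body: "\<exists>s'. runs body s (T (Br (s j) (Br (s (j+2)) (left (s (j+1))))) + 12) s' \<and>
      s' (j+2) = step (s j) (s (j+2)) (left (s (j+1))) \<and> s' (j+1) = right (s (j+1)) \<and> (\<forall>i<j+1. s' i = s i)" for s
  proof -
    let ?s = "s(j+3 := Br (s j) (Br (s (j+2)) (left (s (j+1)))))"
    obtain s1 where s1: "runs r ?s (T (?s (j+3))) s1"
      "s1 (j+3) = step (left (?s (j+3))) (left (right (?s (j+3)))) (right (right (?s (j+3))))"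
      "\<forall>i<j+3. s1 i = ?s i"
      using r by (rule comp_atE)
    let ?s2 = "s1(j+2 := s1 (j+3))"
    let ?s3 = "?s2(j+1 := right (?s2 (j+1)))"
    have a: "runs (Assign (j+3) (Cons_expr (Var j) (Cons_expr (Var (j+2)) (Hd (Var (j+1)))))) s 7 ?s"
      using runs_Assign[of "j+3" "Cons_expr (Var j) (Cons_expr (Var (j+2)) (Hd (Var (j+1))))" s]
      by (simp add: numeral_eq_Suc)
    have b: "runs (Assign (j+2) (Var (j+3))) s1 2 ?s2"
      using runs_Assign[of "j+2" "Var (j+3)" s1] by (simp add: numeral_eq_Suc)
    have c: "runs (Assign (j+1) (Tl (Var (j+1)))) ?s2 3 ?s3"
      using runs_Assign[of "j+1" "Tl (Var (j+1))" ?s2] by (simp add: numeral_eq_Suc)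
    have d: "runs body s (T (Br (s j) (Br (s (j+2)) (left (s (j+1))))) + 12) ?s3"
      unfolding body_def
      by (rule runs_mono[OF runs_Seq[OF a runs_Seq[OF s1(1) runs_Seq[OF b c]]]]) simp
    have "?s3 (j+2) = step (s j) (s (j+2)) (left (s (j+1)))" using s1(2) by simp
    moreover have "?s3 (j+1) = right (s (j+1))" using s1(3) by simp
    moreover have "\<forall>i<j+1. ?s3 i = s i" using s1(3) by simp
    ultimately show ?thesis using d by blast
  qed
  \<comment> \<open>Induction on the tree in register \<open>j+1\<close>, for arbitrary stores: a
    prefix of the tail becomes a prefix of the whole list by adding the head, so the bound
    \<open>b\<close> is inherited. One round costs 12 besides \<open>T\<close>, and the test
    2.\<close>
  have loop: "\<exists>s'. runs (While (Var (j+1)) body) s (length (list_of (s (j+1))) * (b + 14) + 2) s' \<and>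
      s' (j+2) = foldl (step (s j)) (s (j+2)) (list_of (s (j+1))) \<and> (\<forall>i<j+1. s' i = s i)"
    if "\<And>ys e zs. list_of (s (j+1)) = ys @ e # zs \<Longrightarrow>
      T (Br (s j) (Br (foldl (step (s j)) (s (j+2)) ys) e)) \<le> b" for s b
    using that
  proof (induction "s (j+1)" arbitrary: s)
    case Leaf
    have "runs (While (Var (j+1)) body) s 2 s"
      using runs_WhileFalse[of "Var (j+1)" s body] Leaf.hyps by (simp add: numeral_2_eq_2)
    then show ?case using Leaf.hyps[symmetric] by (intro exI[of _ s]) (simp add: numeral_2_eq_2)
  next
    case (Br h t)
    note h = Br.hyps(3)[symmetric]
    obtain s1 where s1: "runs body s (T (Br (s j) (Br (s (j+2)) h)) + 12) s1"
      "s1 (j+2) = step (s j) (s (j+2)) h" "s1 (j+1) = t" "\<forall>i<j+1. s1 i = s i"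
      using body[of s] unfolding h by auto
    have "\<exists>s'. runs (While (Var (j+1)) body) s1 (length (list_of (s1 (j+1))) * (b + 14) + 2) s' \<and>
      s' (j+2) = foldl (step (s1 j)) (s1 (j+2)) (list_of (s1 (j+1))) \<and> (\<forall>i<j+1. s' i = s1 i)"
    proof (rule Br.hyps(2)[of s1])
      show "t = s1 (j + 1)" using s1(3) by simp
    next
      fix ys e zs
      assume "list_of (s1 (j + 1)) = ys @ e # zs"
      then show "T (Br (s1 j) (Br (foldl (step (s1 j)) (s1 (j + 2)) ys) e)) \<le> b"
        using Br.prems[of "h # ys" e zs] s1 by (simp add: h[simplified])
    qed
    then obtain s2 where s2: "runs (While (Var (j+1)) body) s1 (length (list_of t) * (b + 14) + 2) s2"
      "s2 (j+2) = foldl (step (s j)) (step (s j) (s (j+2)) h) (list_of t)" "\<forall>i<j+1. s2 i = s i"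
      using s1 by auto
    have "T (Br (s j) (Br (s (j+2)) h)) \<le> b"
      using Br.prems[of "[]" h "list_of t"] h by simp
    then have "runs (While (Var (j+1)) body) s (length (list_of (Br h t)) * (b + 14) + 2) s2"
      by (intro runs_mono[OF runs_WhileTrue[OF _ s1(1) s2(1)]]) (simp_all add: h[simplified])
    then show ?case using s2 h by (intro exI[of _ s2]) simp
  qed
  let ?p = "Seq p (Seq q (Seq (While (Var (j+1)) body) (Assign j (Var (j+2)))))"
  have "comp_at j j ?p (\<lambda>x. foldl (step x) (A x) (list_of (L x)))
    (\<lambda>x. TL x + TA x + length (list_of (L x)) * (B x + 20) + 20)"
  proof (rule comp_atI)
    fix s
    obtain s1 where s1: "runs p s (2 + TL (s j)) s1" "s1 (j+1) = L (s j)" "\<forall>i<j+1. s1 i = s i"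
      using p by (rule comp_atE)
    obtain s2 where s2: "runs q s1 (2 + TA (s1 j)) s2" "s2 (j+2) = A (s1 j)" "\<forall>i<j+2. s2 i = s1 i"
      using q by (rule comp_atE)
    have *: "s2 j = s j" "s2 (j+1) = L (s j)" "s2 (j+2) = A (s j)" "s1 j = s j" using s1 s2 by auto
    obtain s3 where s3: "runs (While (Var (j+1)) body) s2 (length (list_of (L (s j))) * (B (s j) + 14) + 2) s3"
      "s3 (j+2) = foldl (step (s j)) (A (s j)) (list_of (L (s j)))" "\<forall>i<j+1. s3 i = s2 i"
      using loop[of s2 "B (s j)"] B[of "s j"] unfolding * by blast
    have "runs ?p s (TL (s j) + TA (s j) + length (list_of (L (s j))) * (B (s j) + 20) + 20) (s3(j := s3 (j+2)))"
      using runs_mono[OF runs_Seq[OF s1(1) runs_Seq[OF s2(1) runs_Seq[OF s3(1) runs_Assign[of j "Var (j+2)"]]]],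
          of "TL (s j) + TA (s j) + length (list_of (L (s j))) * (B (s j) + 20) + 20"]
      by (simp add: * algebra_simps)
    then show "\<exists>s'. runs ?p s (TL (s j) + TA (s j) + length (list_of (L (s j))) * (B (s j) + 20) + 20) s' \<and>
      s' j = foldl (step (s j)) (A (s j)) (list_of (L (s j))) \<and> (\<forall>i<j. s' i = s i)"
      using s1 s2 s3 by (intro exI[of _ "s3(j := s3 (j+2))"]) simp
  qed
  then show "\<exists>p. comp_at j j p (\<lambda>x. foldl (step x) (A x) (list_of (L x)))
    (\<lambda>x. TL x + TA x + length (list_of (L x)) * (B x + 20) + 20)"
    by blast
qed

section \<open>Polynomial time\<close>

text \<open>A base of at least 2 lets a single power absorb constants and sums. The measure
  \<open>Z\<close> is a parameter because the size of the input is too small a measure for functions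
  with exponential output.\<close>

definition poly_in :: "(bt \<Rightarrow> nat) \<Rightarrow> (bt \<Rightarrow> nat) \<Rightarrow> bool" where
  "poly_in Z g \<longleftrightarrow> (\<exists>d. \<forall>x. g x \<le> (Z x + 2) ^ d)"

lemma poly_in_mono: "poly_in Z g \<Longrightarrow> (\<And>x. f x \<le> g x) \<Longrightarrow> poly_in Z f"
  unfolding poly_in_def by (meson order_trans)

lemma poly_in_self: "poly_in Z Z"
  unfolding poly_in_def by (rule exI[of _ 1]) simp

lemma poly_in_const: "poly_in Z (\<lambda>x. c)"
  unfolding poly_in_def
proof (rule exI[of _ c], rule allI)
  fix x
  have "c \<le> 2 ^ c" by (rule less_imp_le) simp
  also have "2 ^ c \<le> (Z x + 2) ^ c" by (rule power_mono) simp_all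
  finally show "c \<le> (Z x + 2) ^ c" .
qed

lemma poly_in_mult:
  assumes "poly_in Z f" "poly_in Z g"
  shows "poly_in Z (\<lambda>x. f x * g x)"
proof -
  obtain d e where "\<And>x. f x \<le> (Z x + 2) ^ d" "\<And>x. g x \<le> (Z x + 2) ^ e"
    using assms unfolding poly_in_def by blast
  then have "f x * g x \<le> (Z x + 2) ^ (d + e)" for x
    unfolding power_add by (rule mult_mono) simp_all
  then show ?thesis unfolding poly_in_def by blast
qed

text \<open>Reduced to products by \<open>f + g <= (f + 1) * (g + 1)\<close>; the added 1 costs one
  more factor of the base.\<close>

lemma poly_in_add:
  assumes "poly_in Z f" "poly_in Z g"
  shows "poly_in Z (\<lambda>x. f x + g x)"
proof -
  obtain d e where de: "\<And>x. f x \<le> (Z x + 2) ^ d" "\<And>x. g x \<le> (Z x + 2) ^ e"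
    using assms unfolding poly_in_def by blast
  have suc: "(Z x + 2) ^ d + 1 \<le> (Z x + 2) ^ (d + 1)" for x d
  proof -
    have "1 \<le> (Z x + 2) ^ d" by simp
    then have "(Z x + 2) ^ d + 1 \<le> (Z x + 2) ^ d * 2" by linarith
    also have "\<dots> \<le> (Z x + 2) ^ d * (Z x + 2)" by (rule mult_left_mono) simp_all
    finally show ?thesis by (simp add: algebra_simps)
  qed
  have "poly_in Z (\<lambda>x. f x + 1)"
    unfolding poly_in_def by (rule exI[of _ "d + 1"]) (meson add_le_mono1 de(1) order_trans suc)
  moreover have "poly_in Z (\<lambda>x. g x + 1)"
    unfolding poly_in_def by (rule exI[of _ "e + 1"]) (meson add_le_mono1 de(2) order_trans suc)
  ultimately have "poly_in Z (\<lambda>x. (f x + 1) * (g x + 1))" by (rule poly_in_mult)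
  then show ?thesis by (rule poly_in_mono) simp
qed

lemma poly_in_power: "poly_in Z f \<Longrightarrow> poly_in Z (\<lambda>x. f x ^ n)"
  by (induction n) (simp_all add: poly_in_const poly_in_mult)

lemma poly_in_compose:
  assumes "poly_in Y g" "poly_in Z (\<lambda>x. Y (F x))"
  shows "poly_in Z (\<lambda>x. g (F x))"
proof -
  obtain d where d: "\<And>x. g x \<le> (Y x + 2) ^ d" using assms(1) unfolding poly_in_def by blast
  have "poly_in Z (\<lambda>x. (Y (F x) + 2) ^ d)"
    by (intro poly_in_power poly_in_add poly_in_const assms(2))
  then show ?thesis by (rule poly_in_mono) (rule d)
qed

section \<open>Polynomial-time functions and their closure properties\<close>

definition ptime_in :: "(bt \<Rightarrow> nat) \<Rightarrow> (bt \<Rightarrow> bt) \<Rightarrow> bool" where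
  "ptime_in Z F \<longleftrightarrow> poly_in Z (\<lambda>x. nodes (F x)) \<and> (\<exists>T. poly_in Z T \<and> comp_in F T)"

text \<open>
  The bound on \<open>nodes\<close> does not follow from the bound on the time: a tree of size exponential in
  \<open>t\<close> can be built in time \<open>t\<close> by sharing subtrees.
\<close>

abbreviation ptime :: "(bt \<Rightarrow> bt) \<Rightarrow> bool" where
  "ptime \<equiv> ptime_in nodes"

abbreviation pdec :: "(bt \<Rightarrow> bool) \<Rightarrow> bool" where
  "pdec P \<equiv> ptime (\<lambda>x. enc_bool (P x))"

lemma ptime_inD: "ptime_in Z F \<Longrightarrow> poly_in Z (\<lambda>x. nodes (F x))"
  by (simp add: ptime_in_def)

lemma ptime_inE:
  assumes "ptime_in Z F"
  obtains T where "poly_in Z T" "comp_in F T"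
  using assms unfolding ptime_in_def by blast

lemma ptime_inI: "poly_in Z (\<lambda>x. nodes (F x)) \<Longrightarrow> poly_in Z T \<Longrightarrow> comp_in F T \<Longrightarrow> ptime_in Z F"
  unfolding ptime_in_def by blast

lemma ptime_id: "ptime (\<lambda>x. x)"
  by (rule ptime_inI[OF _ _ comp_in_id]) (rule poly_in_self poly_in_const)+

lemma ptime_in_Leaf: "ptime_in Z (\<lambda>x. Leaf)"
  by (rule ptime_inI[OF _ _ comp_in_Leaf]) (rule poly_in_const)+

lemma ptime_in_compose:
  assumes "ptime_in Y G" "ptime_in Z F" "poly_in Z (\<lambda>x. Y (F x))"
  shows "ptime_in Z (\<lambda>x. G (F x))"
proof -
  obtain T where T: "poly_in Y T" "comp_in G T" using assms(1) by (rule ptime_inE)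
  obtain U where U: "poly_in Z U" "comp_in F U" using assms(2) by (rule ptime_inE)
  show ?thesis
    by (rule ptime_inI[OF _ _ comp_in_compose[OF U(2) T(2)]])
      (intro poly_in_add U(1) poly_in_compose[OF T(1) assms(3)]
        poly_in_compose[OF ptime_inD[OF assms(1)] assms(3)])+
qed

lemma ptime_compose: "ptime G \<Longrightarrow> ptime_in Z F \<Longrightarrow> ptime_in Z (\<lambda>x. G (F x))"
  by (rule ptime_in_compose[OF _ _ ptime_inD])

lemma nodes_pos: "0 < nodes x"
  by (cases x) simp_all

lemma nodes_left: "nodes (left x) \<le> nodes x" and nodes_right: "nodes (right x) \<le> nodes x"
  by (cases x; simp)+

lemma ptime_in_left: "ptime_in Z F \<Longrightarrow> ptime_in Z (\<lambda>x. left (F x))"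
  by (rule ptime_compose[of left], rule ptime_inI[OF _ _ comp_in_left])
    (rule poly_in_mono[OF poly_in_self nodes_left] poly_in_const | assumption)+

lemma ptime_in_right: "ptime_in Z F \<Longrightarrow> ptime_in Z (\<lambda>x. right (F x))"
  by (rule ptime_compose[of right], rule ptime_inI[OF _ _ comp_in_right])
    (rule poly_in_mono[OF poly_in_self nodes_right] poly_in_const | assumption)+

lemma ptime_in_Br:
  assumes "ptime_in Z F" "ptime_in Z G"
  shows "ptime_in Z (\<lambda>x. Br (F x) (G x))"
proof -
  obtain T where T: "poly_in Z T" "comp_in F T" using assms(1) by (rule ptime_inE)
  obtain U where U: "poly_in Z U" "comp_in G U" using assms(2) by (rule ptime_inE)
  show ?thesis
    by (rule ptime_inI[OF _ _ comp_in_Br[OF T(2) U(2)]], unfold nodes.simps)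
      (intro poly_in_add poly_in_const T U assms[THEN ptime_inD])+
qed

lemma ptime_in_case:
  assumes "ptime_in Z C" "ptime_in Z F" "ptime_in Z G"
  shows "ptime_in Z (\<lambda>x. if C x = Leaf then F x else G x)"
proof -
  obtain T where T: "poly_in Z T" "comp_in C T" using assms(1) by (rule ptime_inE)
  obtain U where U: "poly_in Z U" "comp_in F U" using assms(2) by (rule ptime_inE)
  obtain V where V: "poly_in Z V" "comp_in G V" using assms(3) by (rule ptime_inE)
  have "poly_in Z (\<lambda>x. nodes (F x) + nodes (G x))"
    by (intro poly_in_add assms[THEN ptime_inD])
  then have "poly_in Z (\<lambda>x. nodes (if C x = Leaf then F x else G x))"
    by (rule poly_in_mono) simp
  then show ?thesis
    by (rule ptime_inI[OF _ _ comp_in_if[OF T(2) U(2) V(2)]]) (intro poly_in_add poly_in_const T U V)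
qed

lemma ptime_in_if:
  assumes "ptime_in Z (\<lambda>x. enc_bool (P x))" "ptime_in Z F" "ptime_in Z G"
  shows "ptime_in Z (\<lambda>x. if P x then F x else G x)"
proof -
  have "(\<lambda>x. if P x then F x else G x) = (\<lambda>x. if enc_bool (P x) = Leaf then G x else F x)"
    by (simp add: enc_bool_def fun_eq_iff)
  then show ?thesis using ptime_in_case[OF assms(1,3,2)] by simp
qed

lemma length_list_of_le: "length (list_of x) \<le> nodes x"
  by (induction x) simp_all

lemma nodes_enc_list: "nodes (enc_list xs) = 1 + length xs + sum_list (map nodes xs)"
  by (induction xs) (simp_all add: enc_list_def)

lemma nodes_eq_sum_list: "nodes x = 1 + length (list_of x) + sum_list (map nodes (list_of x))"
  using nodes_enc_list[of "list_of x"] by simp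

lemma nodes_member_le:
  assumes "e \<in> set (list_of x)"
  shows "nodes e \<le> nodes x"
  using member_le_sum_list[of "nodes e" "map nodes (list_of x)"] assms nodes_eq_sum_list[of x] by simp

text \<open>Iterating a polynomial-time step can square the size each time, so a bound on every
  intermediate accumulator has to be supplied. That bound is measured by \<open>Z\<close>, which may
  exceed the input size, while the step itself is polynomial in the tree it receives.\<close>

lemma ptime_fold_bounded:
  assumes step: "ptime (\<lambda>y. step (left y) (left (right y)) (right (right y)))"
    and A: "ptime A" and L: "ptime L" and b: "poly_in Z b" and Z: "\<And>x. nodes x \<le> Z x"
    and bound: "\<And>x ys zs. list_of (L x) = ys @ zs \<Longrightarrow> nodes (foldl (step x) (A x) ys) \<le> b x"
  shows "ptime_in Z (\<lambda>x. foldl (step x) (A x) (list_of (L x)))"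
proof -
  obtain T where T: "poly_in nodes T" "comp_in (\<lambda>y. step (left y) (left (right y)) (right (right y))) T"
    using step by (rule ptime_inE)
  obtain TA where TA: "poly_in nodes TA" "comp_in A TA" using A by (rule ptime_inE)
  obtain TL where TL: "poly_in nodes TL" "comp_in L TL" using L by (rule ptime_inE)
  have sub: "poly_in Z f" if f: "poly_in nodes f" for f
    using poly_in_compose[OF f, of Z "\<lambda>x. x"] poly_in_mono[OF poly_in_self Z] by simp
  obtain d where d: "\<And>x. T x \<le> (nodes x + 2) ^ d" using T(1) unfolding poly_in_def by blast
  define B where "B = (\<lambda>x. (nodes x + (b x + nodes (L x)) + 4) ^ d)"
  have B: "poly_in Z B"
    unfolding B_def by (intro poly_in_power poly_in_add poly_in_const b sub ptime_inD[OF L] poly_in_self)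
  have TB: "T (Br x (Br (foldl (step x) (A x) ys) e)) \<le> B x" if "list_of (L x) = ys @ e # zs" for x ys e zs
  proof -
    have "nodes e \<le> nodes (L x)" using nodes_member_le[of e "L x"] that by simp
    then show ?thesis
      unfolding B_def using bound[OF that]
      by (intro order_trans[OF d] power_mono) simp_all
  qed
  have "comp_in (\<lambda>x. foldl (step x) (A x) (list_of (L x)))
    (\<lambda>x. TL x + TA x + length (list_of (L x)) * (B x + 20) + 20)"
    by (rule comp_in_fold[OF TL(2) TA(2) T(2) TB])
  then have "comp_in (\<lambda>x. foldl (step x) (A x) (list_of (L x)))
    (\<lambda>x. TL x + TA x + nodes (L x) * (B x + 20) + 20)"
    by (rule comp_in_mono) (intro add_mono mult_right_mono length_list_of_le order_refl le0)
  moreover have "poly_in Z (\<lambda>x. TL x + TA x + nodes (L x) * (B x + 20) + 20)"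
    by (intro poly_in_add poly_in_mult poly_in_const B TA(1)[THEN sub] TL(1)[THEN sub]
        ptime_inD[OF L, THEN sub])
  moreover have "poly_in Z (\<lambda>x. nodes (foldl (step x) (A x) (list_of (L x))))"
    by (rule poly_in_mono[OF b]) (rule bound[of _ _ "[]"], simp)
  ultimately show ?thesis by (intro ptime_inI)
qed

lemma nodes_foldl_le:
  assumes "\<And>a e. e \<in> set ys \<Longrightarrow> nodes (f a e) \<le> nodes a + b"
  shows "nodes (foldl f a ys) \<le> nodes a + length ys * b"
  using assms
proof (induction ys arbitrary: a)
  case (Cons e ys)
  have "nodes (foldl f (f a e) ys) \<le> nodes (f a e) + length ys * b"
    using Cons by simp
  then show ?case using Cons.prems[of e a] by simp
qed simp

text \<open>Additive growth by \<open>b x\<close> in each step adds up to at most the length of the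
  list times \<open>b x\<close>.\<close>

lemma ptime_fold:
  assumes step: "ptime (\<lambda>y. step (left y) (left (right y)) (right (right y)))"
    and A: "ptime A" and L: "ptime L" and b: "poly_in nodes b"
    and growth: "\<And>x a e. e \<in> set (list_of (L x)) \<Longrightarrow> nodes (step x a e) \<le> nodes a + b x"
  shows "ptime (\<lambda>x. foldl (step x) (A x) (list_of (L x)))"
proof -
  have p: "poly_in nodes (\<lambda>x. nodes (A x) + nodes (L x) * b x)"
    by (intro poly_in_add poly_in_mult b ptime_inD[OF A] ptime_inD[OF L])
  have "nodes (foldl (step x) (A x) ys) \<le> nodes (A x) + nodes (L x) * b x"
    if l: "list_of (L x) = ys @ zs" for x ys zs
  proof -
    have "nodes (foldl (step x) (A x) ys) \<le> nodes (A x) + length ys * b x"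
      by (rule nodes_foldl_le) (simp add: growth l)
    also have "\<dots> \<le> nodes (A x) + nodes (L x) * b x"
      using length_list_of_le[of "L x"] l by (intro add_left_mono mult_right_mono) simp_all
    finally show ?thesis .
  qed
  from ptime_fold_bounded[where step = step and A = A and L = L and Z = nodes, OF step A L p _ this]
  show ?thesis by simp
qed

section \<open>Polynomial-time predicates\<close>

lemma pdec_not:
  assumes "pdec P"
  shows "pdec (\<lambda>x. \<not> P x)"
proof -
  have "(\<lambda>x. enc_bool (\<not> P x)) = (\<lambda>x. if P x then Leaf else Br Leaf Leaf)"
    by (simp add: enc_bool_def fun_eq_iff)
  then show ?thesis by (simp only:) (intro ptime_in_if assms ptime_in_Leaf ptime_in_Br)
qed

lemma pdec_conj:
  assumes "pdec P" "pdec Q"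
  shows "pdec (\<lambda>x. P x \<and> Q x)"
proof -
  have "(\<lambda>x. enc_bool (P x \<and> Q x)) = (\<lambda>x. if P x then enc_bool (Q x) else Leaf)"
    by (simp add: enc_bool_def fun_eq_iff)
  then show ?thesis by (simp only:) (intro ptime_in_if assms ptime_in_Leaf)
qed

lemma pdec_disj: "pdec P \<Longrightarrow> pdec Q \<Longrightarrow> pdec (\<lambda>x. P x \<or> Q x)"
  using pdec_not[OF pdec_conj[OF pdec_not pdec_not], of P Q] by simp

lemma pdec_eq_Leaf:
  assumes "ptime F"
  shows "pdec (\<lambda>x. F x = Leaf)"
proof -
  have "(\<lambda>x. enc_bool (F x = Leaf)) = (\<lambda>x. if F x = Leaf then Br Leaf Leaf else Leaf)"
    by (simp add: enc_bool_def fun_eq_iff)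
  then show ?thesis by (simp only:) (intro ptime_in_case assms ptime_in_Leaf ptime_in_Br)
qed

lemma pdec_iff:
  assumes "pdec P" "pdec Q"
  shows "pdec (\<lambda>x. P x \<longleftrightarrow> Q x)"
proof -
  have "(\<lambda>x. enc_bool (P x \<longleftrightarrow> Q x)) = (\<lambda>x. if P x then enc_bool (Q x) else enc_bool (\<not> Q x))"
    by (simp add: enc_bool_def fun_eq_iff)
  then show ?thesis by (simp only:) (intro ptime_in_if assms pdec_not)
qed

lemmas ptime_intros = ptime_id ptime_in_Leaf ptime_in_left ptime_in_right ptime_in_Br
  ptime_in_if pdec_not pdec_conj pdec_disj pdec_eq_Leaf pdec_iff

text \<open>A fold that accumulates the disjunction; once the accumulator differs from
  \<open>Leaf\<close>, it is kept.\<close>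

lemma pdec_bex:
  assumes P: "pdec (\<lambda>y. P (left y) (right y))" and L: "ptime L"
  shows "pdec (\<lambda>x. \<exists>e\<in>set (list_of (L x)). P x e)"
proof -
  define step where "step = (\<lambda>x a e. if a = Leaf then enc_bool (P x e) else a)"
  have "step x (enc_bool b) e = enc_bool (b \<or> P x e)" for x b e
    by (simp add: step_def enc_bool_def)
  then have "foldl (step x) (enc_bool b) es = enc_bool (b \<or> (\<exists>e\<in>set es. P x e))" for x b es
    by (induction es arbitrary: b) simp_all
  from this[of _ False]
  have eq: "(\<lambda>x. enc_bool (\<exists>e\<in>set (list_of (L x)). P x e)) = (\<lambda>x. foldl (step x) Leaf (list_of (L x)))"
    by (simp add: enc_bool_def fun_eq_iff)
  have "ptime (\<lambda>y. enc_bool (P (left y) (right (right y))))"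
    using ptime_compose[OF P, of nodes "\<lambda>y. Br (left y) (right (right y))"]
    by (simp add: ptime_intros)
  then have step: "ptime (\<lambda>y. step (left y) (left (right y)) (right (right y)))"
    unfolding step_def by (intro ptime_intros)
  have "nodes (step x a e) \<le> nodes a + 3" for x a e
    by (simp add: step_def enc_bool_def)
  then show ?thesis
    unfolding eq by (rule ptime_fold[OF step ptime_in_Leaf L poly_in_const])
qed

lemma pdec_ball:
  assumes "pdec (\<lambda>y. P (left y) (right y))" "ptime L"
  shows "pdec (\<lambda>x. \<forall>e\<in>set (list_of (L x)). P x e)"
  using pdec_not[OF pdec_bex[OF pdec_not[OF assms(1)] assms(2)]] by simp

section \<open>The algorithm\<close>

text \<open>Prepends in reverse order, as one pass over the list does naturally. On unary numbers it
  is addition.\<close>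

definition push :: "bt \<Rightarrow> bt \<Rightarrow> bt" where
  "push l a = foldl (\<lambda>a e. Br e a) a (list_of l)"

lemma list_of_push: "list_of (push l a) = rev (list_of l) @ list_of a"
proof -
  have "list_of (foldl (\<lambda>a e. Br e a) a xs) = rev xs @ list_of a" for xs
    by (induction xs arbitrary: a) simp_all
  then show ?thesis by (simp add: push_def)
qed

lemma nodes_push: "nodes (push l a) + 1 = nodes l + nodes a"
  by (simp add: nodes_eq_sum_list list_of_push sum_list_rev rev_map[symmetric])

lemma ptime_push:
  assumes "ptime F" "ptime G"
  shows "ptime (\<lambda>x. push (F x) (G x))"
  unfolding push_def
proof (rule ptime_fold[where step = "\<lambda>x a e. Br e a", OF _ assms(2,1)])
  show "poly_in nodes (\<lambda>x. nodes (F x) + 1)"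
    by (intro poly_in_add poly_in_const ptime_inD assms)
qed (intro ptime_intros | simp add: nodes_member_le)+

text \<open>On unary numbers this is truncated subtraction of \<open>l\<close> from
  \<open>r\<close>.\<close>

definition shorten :: "bt \<Rightarrow> bt \<Rightarrow> bt" where
  "shorten l r = foldl (\<lambda>r e. right r) r (list_of l)"

lemma list_of_shorten: "list_of (shorten l r) = drop (length (list_of l)) (list_of r)"
proof -
  have "list_of (foldl (\<lambda>r e. right r) r xs) = drop (length xs) (list_of r)" for xs
    by (induction xs arbitrary: r) (simp_all add: list_of_right drop_Suc)
  then show ?thesis by (simp add: shorten_def)
qed

lemma nodes_shorten: "nodes (shorten l r) \<le> nodes r"
  using nodes_foldl_le[of "list_of l" "\<lambda>r e. right r" 0 r] by (simp add: shorten_def nodes_right)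

lemma ptime_shorten:
  assumes "ptime F" "ptime G"
  shows "ptime (\<lambda>x. shorten (F x) (G x))"
  unfolding shorten_def
  by (rule ptime_fold[where step = "\<lambda>x r e. right r", OF _ assms(2,1) poly_in_const[of nodes 0]])
    (intro ptime_intros | simp add: nodes_right)+

text \<open>The list \<open>p\<close> is only a counter. The accumulator pairs the unread part of
  \<open>l\<close> with the reversed part already read.\<close>

definition clip :: "bt \<Rightarrow> bt \<Rightarrow> bt" where
  "clip p l = right (foldl (\<lambda>a e. if left a = Leaf then a
     else Br (right (left a)) (Br (left (left a)) (right a))) (Br l Leaf) (list_of p))"

lemma list_of_clip: "list_of (clip p l) = rev (take (length (list_of p)) (list_of l))"
proof -
  have *: "list_of (right (foldl (\<lambda>a e. if left a = Leaf then a
     else Br (right (left a)) (Br (left (left a)) (right a))) (Br l m) xs)) =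
     rev (take (length xs) (list_of l)) @ list_of m" for xs l m
  proof (induction xs arbitrary: l m)
    case (Cons e xs)
    then show ?case by (cases l) simp_all
  qed simp
  show ?thesis using *[of l Leaf "list_of p"] unfolding clip_def by simp
qed

lemma ptime_clip:
  assumes "ptime F" "ptime G"
  shows "ptime (\<lambda>x. clip (F x) (G x))"
proof -
  let ?step = "\<lambda>(x :: bt) a (e :: bt). if left a = Leaf then a
     else Br (right (left a)) (Br (left (left a)) (right a))"
  have "nodes (?step x a e) \<le> nodes a + 0" for x a e
    by (cases a rule: bt.exhaust; cases "left a" rule: bt.exhaust) simp_all
  then have "ptime (\<lambda>x. foldl (?step x) (Br (G x) Leaf) (list_of (F x)))"
    by (rule ptime_fold[where step = ?step, OF _ _ assms(1) poly_in_const, rotated -1])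
      (intro ptime_intros assms)+
  then show ?thesis unfolding clip_def by (rule ptime_in_right)
qed

text \<open>The reversal caused by \<open>push\<close> is undone by the one in \<open>clip\<close>
  whenever nothing is cut off.\<close>

definition cat :: "(bt \<Rightarrow> bt) \<Rightarrow> bt \<Rightarrow> bt" where
  "cat f l = foldl (\<lambda>a e. push (f e) a) Leaf (list_of l)"

lemma list_of_cat: "list_of (cat f l) = rev (concat (map (\<lambda>e. list_of (f e)) (list_of l)))"
proof -
  have "list_of (foldl (\<lambda>a e. push (f e) a) a xs) = rev (concat (map (\<lambda>e. list_of (f e)) xs)) @ list_of a" for a xs
    by (induction xs arbitrary: a) (simp_all add: list_of_push)
  then show ?thesis by (simp add: cat_def)
qed

lemma ptime_cat:
  assumes f: "ptime (\<lambda>y. f (left y) (right y))" and L: "ptime L"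
  shows "ptime (\<lambda>x. cat (f x) (L x))"
  unfolding cat_def
proof -
  obtain d where d: "\<And>y. nodes (f (left y) (right y)) \<le> (nodes y + 2) ^ d"
    using ptime_inD[OF f] unfolding poly_in_def by blast
  show "ptime (\<lambda>x. foldl (\<lambda>a e. push (f x e) a) Leaf (list_of (L x)))"
  proof (rule ptime_fold[where step = "\<lambda>x a e. push (f x e) a", OF _ ptime_in_Leaf L])
    have "ptime (\<lambda>y. f (left y) (right (right y)))"
      using ptime_compose[OF f, of nodes "\<lambda>y. Br (left y) (right (right y))"]
      by (simp add: ptime_intros)
    then show "ptime (\<lambda>y. push (f (left y) (right (right y))) (left (right y)))"
      by (intro ptime_push ptime_intros)
    show "poly_in nodes (\<lambda>x. (nodes x + nodes (L x) + 3) ^ d)"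
      by (intro poly_in_power poly_in_add poly_in_const poly_in_self ptime_inD L)
    fix x a e
    assume "e \<in> set (list_of (L x))"
    then have "nodes (Br x e) + 2 \<le> nodes x + nodes (L x) + 3"
      using nodes_member_le[of e "L x"] by simp
    then have "nodes (f x e) \<le> (nodes x + nodes (L x) + 3) ^ d"
      using order_trans[OF d[of "Br x e"] power_mono] by simp
    then show "nodes (push (f x e) a) \<le> nodes a + (nodes x + nodes (L x) + 3) ^ d"
      using nodes_push[of "f x e" a] by simp
  qed
qed

section \<open>Breadth-first search with clipped lists of states\<close>

text \<open>The accumulator is the list of all states after the edges read so far. Clipping it to
  the length of \<open>p\<close> keeps the search polynomial for every input, at the price that
  states are lost when \<open>p\<close> is too short.\<close>

definition search :: "bt \<Rightarrow> (bt \<Rightarrow> bt \<Rightarrow> bt) \<Rightarrow> bt \<Rightarrow> bt \<Rightarrow> bt" where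
  "search p f a es = foldl (\<lambda>s e. clip p (cat (f e) s)) (Br a Leaf) (list_of es)"

lemma clip_cat_bounds:
  "set (list_of (clip p (cat f s))) \<subseteq> (\<Union>st\<in>set (list_of s). set (list_of (f st)))"
  "length (list_of (clip p (cat f s))) \<le> length (list_of p)"
  using set_take_subset[of "length (list_of p)" "list_of (cat f s)"]
  by (auto simp: list_of_clip list_of_cat)

text \<open>Clipping bounds the number of states and \<open>growth\<close> bounds the size of each
  of them, so the whole list stays polynomial.\<close>

lemma ptime_search:
  assumes f: "ptime (\<lambda>y. f (left y) (left (right y)) (right (right y)))"
    and P: "ptime P" and A: "ptime A" and L: "ptime L" and b: "poly_in nodes b"
    and growth: "\<And>x e s c. e \<in> set (list_of (L x)) \<Longrightarrow> c \<in> set (list_of (f x e s)) \<Longrightarrow>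
      nodes c \<le> nodes s + b x"
  shows "ptime (\<lambda>x. search (P x) (f x) (A x) (L x))"
proof -
  define step where "step = (\<lambda>x s e. clip (P x) (cat (f x e) s))"
  define B where "B = (\<lambda>x. 1 + (nodes (P x) + 1) * (1 + (nodes (A x) + nodes (L x) * b x)))"
  have "ptime (\<lambda>z. f (left (left z)) (right (right (left z))) (right z))"
    using ptime_compose[OF f, of nodes "\<lambda>z. Br (left (left z)) (Br (right (right (left z))) (right z))"]
    by (simp add: ptime_intros)
  then have "ptime (\<lambda>y. cat (f (left y) (right (right y))) (left (right y)))"
    by (rule ptime_cat[where f = "\<lambda>y. f (left y) (right (right y))"]) (intro ptime_intros)
  then have 1: "ptime (\<lambda>y. step (left y) (left (right y)) (right (right y)))"
    unfolding step_def by (intro ptime_clip ptime_compose[OF P] ptime_intros)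
  have 2: "poly_in nodes B"
    unfolding B_def by (intro poly_in_add poly_in_mult poly_in_const b ptime_inD P A L)
  have "nodes (foldl (step x) (Br (A x) Leaf) ys) \<le> B x" if l: "list_of (L x) = ys @ zs" for x ys zs
  proof -
    \<comment> \<open>The extra 1 accounts for the initial list, whose single state is not
      clipped.\<close>
    have *: "length (list_of (foldl (step x) (Br (A x) Leaf) ys)) \<le> length (list_of (P x)) + 1 \<and>
      (\<forall>c\<in>set (list_of (foldl (step x) (Br (A x) Leaf) ys)). nodes c \<le> nodes (A x) + length ys * b x)"
      if "set ys \<subseteq> set (list_of (L x))"
      using that
    proof (induction ys rule: rev_induct)
      case (snoc e ys)
      let ?s = "foldl (step x) (Br (A x) Leaf) ys"
      have "nodes c \<le> nodes (A x) + Suc (length ys) * b x" if c: "c \<in> set (list_of (step x ?s e))" for c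
      proof -
        obtain s where s: "s \<in> set (list_of ?s)" "c \<in> set (list_of (f x e s))"
          using c clip_cat_bounds(1) unfolding step_def by blast
        then have "nodes s \<le> nodes (A x) + length ys * b x" using snoc by simp
        moreover have "nodes c \<le> nodes s + b x" using growth[of e x c s] s snoc.prems by simp
        ultimately show ?thesis by simp
      qed
      then show ?case using clip_cat_bounds(2)[of "P x" "f x e" ?s] by (simp add: step_def)
    qed simp
    let ?r = "foldl (step x) (Br (A x) Leaf) ys" and ?n = "nodes (A x) + nodes (L x) * b x"
    have len: "length (list_of ?r) \<le> nodes (P x) + 1"
      using * l length_list_of_le[of "P x"] by simp
    have "length ys * b x \<le> nodes (L x) * b x"
      using length_list_of_le[of "L x"] l by (intro mult_right_mono) simp_all
    then have "nodes (A x) + length ys * b x \<le> ?n" by simp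
    then have "nodes c \<le> ?n" if "c \<in> set (list_of ?r)" for c
      using * l that order_trans by fastforce
    then have "sum_list (map nodes (list_of ?r)) \<le> sum_list (map (\<lambda>_. ?n) (list_of ?r))"
      by (rule sum_list_mono)
    then have "nodes ?r \<le> 1 + length (list_of ?r) * (1 + ?n)"
      by (subst nodes_eq_sum_list) (simp add: sum_list_triv algebra_simps)
    also have "\<dots> \<le> B x" unfolding B_def by (intro add_left_mono mult_right_mono len) simp
    finally show ?thesis .
  qed
  from ptime_fold_bounded[where step = step and A = "\<lambda>x. Br (A x) Leaf" and L = L and Z = nodes,
      OF 1 ptime_in_Br[OF A ptime_in_Leaf] L 2 _ this]
  show ?thesis by (simp add: search_def step_def)
qed

text \<open>The leaves of the search tree without any clipping, as the reference for
  \<open>search\<close>.\<close>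

fun paths :: "('e \<Rightarrow> 's \<Rightarrow> 's list) \<Rightarrow> 'e list \<Rightarrow> 's \<Rightarrow> 's list" where
  "paths f [] s = [s]"
| "paths f (e # es) s = concat (map (paths f es) (f e s))"

text \<open>A weight \<open>w\<close> that no branching increases bounds the number of states, so nothing is clipped.\<close>

lemma set_search:
  assumes pos: "\<And>es s. 1 \<le> w es s"
    and w: "\<And>e es s. e \<in> set (list_of es0) \<Longrightarrow> sum_list (map (w es) (list_of (f e s))) \<le> w (e # es) s"
    and p: "w (list_of es0) a \<le> length (list_of p)"
  shows "set (list_of (search p f a es0)) = set (paths (\<lambda>e s. list_of (f e s)) (list_of es0) a)"
proof -
  have "set (list_of (foldl (\<lambda>s e. clip p (cat (f e) s)) r es)) =
      (\<Union>s\<in>set (list_of r). set (paths (\<lambda>e s. list_of (f e s)) es s))"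
    if "set es \<subseteq> set (list_of es0)" "sum_list (map (w es) (list_of r)) \<le> length (list_of p)" for es r
    using that
  proof (induction es arbitrary: r)
    case (Cons e es)
    let ?c = "concat (map (\<lambda>s. list_of (f e s)) (list_of r))"
    have "sum_list (map (w es) (concat (map (\<lambda>s. list_of (f e s)) l))) \<le> sum_list (map (w (e # es)) l)" for l
      using w[of e es] Cons.prems(1) by (induction l) (simp_all add: add_mono)
    then have c: "sum_list (map (w es) ?c) \<le> length (list_of p)"
      using Cons.prems(2) order_trans by blast
    \<comment> \<open>Every state weighs at least 1, so the total weight bounds the number of states
      and \<open>clip\<close> removes none.\<close>
    have "sum_list (map (\<lambda>_. 1) ?c) \<le> sum_list (map (w es) ?c)"
      by (rule sum_list_mono) (rule pos)
    then have "length ?c \<le> length (list_of p)" using c by (simp add: sum_list_triv)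
    then have l: "list_of (clip p (cat (f e) r)) = ?c"
      by (simp add: list_of_clip list_of_cat)
    show ?case using Cons.IH[of "clip p (cat (f e) r)"] Cons.prems(1) c unfolding l by (simp add: l)
  qed simp
  from this[of "list_of es0" "Br a Leaf"] show ?thesis using p by (simp add: search_def)
qed

section \<open>Conversion of binary numbers to unary ones\<close>

text \<open>
  Exact only for numbers up to the length of \<open>p\<close>: the powers of two are cut off there, as the
  costs may be exponential in the size of the input.
\<close>

definition unary :: "bt \<Rightarrow> bt \<Rightarrow> bt" where
  "unary p bs = right (foldl (\<lambda>a e. Br (clip p (push (left a) (left a)))
     (if e = Leaf then right a else push (left a) (right a))) (Br (Br Leaf Leaf) Leaf) (list_of bs))"

lemma list_of_Leaves: "list_of (enc_unary n) = replicate n Leaf"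
  by (simp add: enc_unary_def)

lemma nodes_unary: "nodes (enc_unary n) = 2 * n + 1"
  by (simp add: enc_unary_def nodes_enc_list sum_list_replicate)

lemma list_of_eqI: "list_of x = list_of y \<Longrightarrow> x = y"
  by (metis enc_list_list_of)

lemma push_unary: "push (enc_unary m) (enc_unary n) = enc_unary (m + n)"
  by (rule list_of_eqI) (simp add: list_of_push list_of_Leaves replicate_add)

lemma clip_unary: "clip p (enc_unary n) = enc_unary (min n (length (list_of p)))"
  by (rule list_of_eqI) (simp add: list_of_clip list_of_Leaves min.commute)

lemma shorten_unary: "shorten (enc_unary m) (enc_unary n) = enc_unary (n - m)"
  by (rule list_of_eqI) (simp add: list_of_shorten list_of_Leaves)

lemma right_unary: "right (enc_unary n) = enc_unary (n - 1)"
  by (rule list_of_eqI) (simp add: list_of_right list_of_Leaves)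

lemma unary_eq_Leaf [simp]: "enc_unary n = Leaf \<longleftrightarrow> n = 0"
  by (cases n) (simp_all add: enc_unary_def enc_list_def)

text \<open>The number that \<open>unary\<close> accumulates: the place value starts at
  \<open>w\<close> and doubles from digit to digit, cut off at \<open>n\<close>.\<close>

fun capped_value :: "nat \<Rightarrow> nat \<Rightarrow> bt list \<Rightarrow> nat" where
  "capped_value n w [] = 0"
| "capped_value n w (e # es) = (if e = Leaf then 0 else w) + capped_value n (min (w + w) n) es"

abbreviation unary_step :: "bt \<Rightarrow> bt \<Rightarrow> bt \<Rightarrow> bt" where
  "unary_step p a e \<equiv> Br (clip p (push (left a) (left a))) (if e = Leaf then right a else push (left a) (right a))"

lemma unary_fold:
  assumes "w \<le> m" "length (list_of p) \<le> m"
  shows "\<exists>w'\<le>m. foldl (unary_step p) (Br (enc_unary w) (enc_unary n)) es =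
    Br (enc_unary w') (enc_unary (n + capped_value (length (list_of p)) w es))"
  using assms
proof (induction es arbitrary: w n)
  case (Cons e es)
  show ?case
    using Cons.IH[of "min (w + w) (length (list_of p))" "if e = Leaf then n else w + n"] Cons.prems
    by (simp add: push_unary clip_unary add.assoc add.left_commute if_distrib cong: if_cong)
      (auto simp: ac_simps)
qed auto

lemma capped_value_le: "w \<le> m \<Longrightarrow> n \<le> m \<Longrightarrow> capped_value n w es \<le> length es * m"
  by (induction es arbitrary: w) (auto simp: add_mono trans_le_add2)

text \<open>Cutting off a place value can only lower the result. It does no harm below
  \<open>m\<close>: once a place value has been cut to \<open>m\<close>, any nonzero remaining part
  contributes at least \<open>m\<close>.\<close>

lemma capped_value_bits:
  "min (w * n) m \<le> capped_value m w (map enc_bool (bits n)) \<and> capped_value m w (map enc_bool (bits n)) \<le> w * n"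
proof (induction n arbitrary: w rule: bits.induct)
  case (2 n)
  let ?h = "Suc n div 2"
  let ?w = "min (w + w) m"
  let ?v = "capped_value m ?w (map enc_bool (bits ?h))"
  have n: "Suc n = 2 * ?h + (if odd (Suc n) then 1 else 0)" by presburger
  have v: "capped_value m w (map enc_bool (bits (Suc n))) = (if odd (Suc n) then w else 0) + ?v"
    by (simp add: enc_bool_def)
  have wn: "w * Suc n = (w + w) * ?h + (if odd (Suc n) then w else 0)"
    by (subst n) (simp add: algebra_simps)
  have le: "?v \<le> (w + w) * ?h"
    using 2[of ?w] by (meson min.cobounded1 mult_right_mono order_trans zero_le)
  have "min ((w + w) * ?h) m \<le> ?v"
  proof (cases "w + w \<le> m \<or> ?h = 0")
    case True
    then show ?thesis using 2[of ?w] by (auto simp: min_def)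
  next
    case False
    then have "min (m * ?h) m = m" "?w = m" by simp_all
    then have "m \<le> ?v" using 2[of ?w] by simp
    then show ?thesis by simp
  qed
  then show ?case unfolding v wn using le by (auto simp: min_def split: if_splits)
qed simp

lemma unary_enc_nat:
  obtains v where "unary p (enc_nat n) = enc_unary v" "min n (length (list_of p)) \<le> v" "v \<le> n"
proof -
  obtain v where v: "v = capped_value (length (list_of p)) 1 (map enc_bool (bits n))" by simp
  have "Br (Br Leaf Leaf) Leaf = Br (enc_unary 1) (enc_unary 0)"
    by (simp add: enc_unary_def enc_list_def)
  \<comment> \<open>The bound is one more than the length of \<open>p\<close> because the place
    value starts at 1 even if \<open>p\<close> is empty.\<close>
  then have "unary p (enc_nat n) = enc_unary v"
    using unary_fold[of 1 "Suc (length (list_of p))" p 0 "map enc_bool (bits n)"]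
    unfolding unary_def v by (auto simp: enc_nat_def)
  then show ?thesis using that capped_value_bits[of 1 n "length (list_of p)"] v by auto
qed

lemma ptime_unary:
  assumes "ptime P" "ptime L"
  shows "ptime (\<lambda>x. unary (P x) (L x))"
proof -
  let ?A = "Br (Br Leaf Leaf) Leaf"
  let ?b = "\<lambda>x. 2 * (nodes (P x) + 1) + 2 * (nodes (L x) * (nodes (P x) + 1)) + 3"
  have A: "?A = Br (enc_unary 1) (enc_unary 0)"
    by (simp add: enc_unary_def enc_list_def)
  have 1: "ptime (\<lambda>y. unary_step (P (left y)) (left (right y)) (right (right y)))"
    by (intro ptime_intros ptime_clip ptime_push ptime_compose[OF assms(1)])
  have 2: "poly_in nodes ?b"
    by (intro poly_in_add poly_in_mult poly_in_const ptime_inD assms)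
  have "nodes (foldl (unary_step (P x)) ?A ys) \<le> ?b x" if l: "list_of (L x) = ys @ zs" for x ys zs
  proof -
    let ?p = "length (list_of (P x))"
    have p: "?p \<le> nodes (P x)" by (rule length_list_of_le)
    obtain w where w: "w \<le> nodes (P x) + 1"
      "foldl (unary_step (P x)) ?A ys = Br (enc_unary w) (enc_unary (capped_value ?p 1 ys))"
      using unary_fold[of 1 "nodes (P x) + 1" "P x" 0 ys] p unfolding A by auto
    have "capped_value ?p 1 ys \<le> length ys * (nodes (P x) + 1)"
      by (rule capped_value_le) (use p in simp_all)
    also have "\<dots> \<le> nodes (L x) * (nodes (P x) + 1)"
      using length_list_of_le[of "L x"] l by (intro mult_right_mono) simp_all
    finally show ?thesis using w by (simp add: nodes_unary)
  qed
  from ptime_fold_bounded[where step = "\<lambda>x. unary_step (P x)" and A = "\<lambda>x. ?A" and L = L and Z = nodes,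
      OF 1 _ assms(2) 2 _ this]
  show ?thesis unfolding unary_def by (intro ptime_in_right) (simp add: ptime_intros)
qed

section \<open>Comparison of vertex names\<close>

text \<open>The left component of the state is \<open>Leaf\<close> once a mismatch has been found.\<close>

definition digits_eq :: "bt \<Rightarrow> bt \<Rightarrow> bool" where
  "digits_eq x y \<longleftrightarrow> (let a = foldl (\<lambda>a e.
     if left a \<noteq> Leaf \<and> right a \<noteq> Leaf \<and> (e = Leaf \<longleftrightarrow> left (right a) = Leaf)
     then Br (left a) (right (right a)) else Leaf) (Br (Br Leaf Leaf) y) (list_of x)
   in left a \<noteq> Leaf \<and> right a = Leaf)"

lemma pdec_digits_eq:
  assumes "ptime F" "ptime G"
  shows "pdec (\<lambda>x. digits_eq (F x) (G x))"
proof -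
  let ?step = "\<lambda>(x :: bt) a e. if left a \<noteq> Leaf \<and> right a \<noteq> Leaf \<and> (e = Leaf \<longleftrightarrow> left (right a) = Leaf)
     then Br (left a) (right (right a)) else Leaf"
  have "nodes (?step x a e) \<le> nodes a + 2" for x a e
    using nodes_right[of "right a"] by (cases a) (auto simp: Suc_le_eq nodes_pos)
  then have "ptime (\<lambda>x. foldl (?step x) (Br (Br Leaf Leaf) (G x)) (list_of (F x)))"
    by (rule ptime_fold[where step = ?step, OF _ _ assms(1) poly_in_const, rotated -1])
      (intro ptime_intros assms)+
  then show ?thesis unfolding digits_eq_def Let_def by (intro ptime_intros)
qed

lemma digits_eq_enc_nat: "digits_eq (enc_nat m) (enc_nat n) \<longleftrightarrow> m = n"
proof -
  let ?step = "\<lambda>a e. if left a \<noteq> Leaf \<and> right a \<noteq> Leaf \<and> (e = Leaf \<longleftrightarrow> left (right a) = Leaf)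
     then Br (left a) (right (right a)) else Leaf"
  \<comment> \<open>A mismatch is final, since \<open>Leaf\<close> is a fixed point of the
    step.\<close>
  have Leaf: "foldl ?step Leaf es = Leaf" for es by (induction es) simp_all
  have "(let a = foldl ?step (Br (Br Leaf Leaf) (enc_list (map enc_bool ys))) (map enc_bool xs)
    in left a \<noteq> Leaf \<and> right a = Leaf) \<longleftrightarrow> xs = ys" for xs ys
  proof (induction xs arbitrary: ys)
    case Nil
    then show ?case by (cases ys) (simp_all add: enc_list_def)
  next
    case (Cons x xs)
    show ?case
    proof (cases ys)
      case Nil
      then show ?thesis by (simp add: enc_list_def Leaf)
    next
      case (Cons y ys')
      then show ?thesis using Cons.IH[of ys'] by (cases x; cases y) (simp_all add: enc_list_def enc_bool_def Leaf)
    qed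
  qed
  then have "digits_eq (enc_nat m) (enc_nat n) \<longleftrightarrow> bits m = bits n"
    by (simp add: digits_eq_def enc_nat_def)
  \<comment> \<open>A number is determined by its parity and its half.\<close>
  moreover have "m = n" if "bits m = bits n"
    using that
  proof (induction m arbitrary: n rule: bits.induct)
    case 1
    then show ?case by (cases n) simp_all
  next
    case (2 m)
    then obtain k where k: "n = Suc k" by (cases n) simp_all
    then have "Suc m div 2 = Suc k div 2" "odd (Suc m) = odd (Suc k)" using 2 by simp_all
    then show ?case unfolding k by presburger
  qed
  ultimately show ?thesis by blast
qed

definition touches :: "bt \<Rightarrow> bt \<Rightarrow> bt \<Rightarrow> bool" where
  "touches u v U \<longleftrightarrow> (\<exists>w\<in>set (list_of U). digits_eq w u \<or> digits_eq w v)"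

lemma pdec_touches:
  assumes "ptime F" "ptime G" "ptime H"
  shows "pdec (\<lambda>x. touches (F x) (G x) (H x))"
  unfolding touches_def
  by (rule pdec_bex[where P = "\<lambda>x w. digits_eq w (F x) \<or> digits_eq w (G x)"])
    (intro pdec_disj pdec_digits_eq ptime_intros assms ptime_compose[OF assms(1)] ptime_compose[OF assms(2)])+

section \<open>The two branching rules on trees\<close>

text \<open>
  A state of the branching consists of the remaining fuel and one more than the remaining budget
  (so that \<open>Leaf\<close> means overspent), both in unary, the list \<open>U\<close> and the list \<open>F\<close>.
\<close>

definition branch :: "bt \<Rightarrow> bt \<Rightarrow> bt \<Rightarrow> bt" where
  "branch p e s =
    (if touches (left (left e)) (right (left e)) (left (right s)) then Br s Leaf
     else if left (left s) = Leaf then Leaf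
     else Br (Br (Br (right (left (left s))) (shorten (unary p (right (right e))) (right (left s)))) (right s))
         (Br (Br (Br (right (left (left s))) (right (left s))) (Br (Br (left (left e)) (left (right s))) (right (right s))))
         (Br (Br (Br (right (left (left s))) (right (left s))) (Br (Br (right (left e)) (left (right s))) (right (right s))))
         (Br (Br (Br (right (left (left s))) (right (left s))) (Br (left (right s)) (Br e (right (right s))))) Leaf))))"

lemma ptime_branch:
  "ptime F \<Longrightarrow> ptime G \<Longrightarrow> ptime H \<Longrightarrow> ptime (\<lambda>x. branch (F x) (G x) (H x))"
  unfolding branch_def by (intro ptime_intros pdec_touches ptime_shorten ptime_unary)

lemma nodes_left_right: "nodes (left x) + nodes (right x) \<le> nodes x + 1"
  by (cases x) simp_all

text \<open>A successor uses each part of \<open>s\<close> at most once, together with parts of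
  \<open>e\<close> and a fixed number of new nodes; this is the additive growth that
  \<open>ptime_search\<close> requires.\<close>

lemma nodes_branch:
  assumes "c \<in> set (list_of (branch p e s))"
  shows "nodes c \<le> nodes s + (nodes e + 20)"
proof -
  note l = nodes_left_right[of s] nodes_left_right[of "left s"] nodes_left_right[of "right s"]
    nodes_right[of "left (left s)"] nodes_shorten[of "unary p (right (right e))" "right (left s)"]
    nodes_left_right[of e] nodes_left_right[of "left e"]
  show ?thesis
    using assms l unfolding branch_def by (auto split: if_splits)
qed

text \<open>
  A matching is given by the list of the vertices it covers, next to the number, in unary, of
  edges it may still receive before it is too large.
\<close>

definition extend_matching :: "bt \<Rightarrow> bt \<Rightarrow> bt" where
  "extend_matching e s =
    (if touches (left (left e)) (right (left e)) (right s) then Br s Leaf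
     else Br s (Br (Br (right (left s)) (Br (left (left e)) (Br (right (left e)) (right s)))) Leaf))"

lemma ptime_extend_matching: "ptime F \<Longrightarrow> ptime G \<Longrightarrow> ptime (\<lambda>x. extend_matching (F x) (G x))"
  unfolding extend_matching_def by (intro ptime_intros pdec_touches)

lemma nodes_extend_matching:
  assumes "c \<in> set (list_of (extend_matching e s))"
  shows "nodes c \<le> nodes s + (nodes e + 20)"
proof -
  note l = nodes_left_right[of s] nodes_right[of "left s"] nodes_left_right[of e] nodes_left_right[of "left e"]
  show ?thesis
    using assms l unfolding extend_matching_def by (auto split: if_splits)
qed

section \<open>The acceptance test\<close>

text \<open>In \<open>accept\<close> the argument \<open>m\<close> is one more than the target, so a
  counter becomes \<open>Leaf\<close> exactly when \<open>U\<close> and the matching together exceed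
  the target. If \<open>U\<close> alone does, already the empty matching fails the test.\<close>

definition good :: "bt \<Rightarrow> bt \<Rightarrow> bt \<Rightarrow> bool" where
  "good pad m s \<longleftrightarrow> right (left s) \<noteq> Leaf \<and>
    (\<forall>M\<in>set (list_of (search pad extend_matching (Br (shorten (left (right s)) m) Leaf) (right (right s)))). left M \<noteq> Leaf)"

text \<open>The list \<open>p\<close> serves as initial fuel and as the cutoff in
  \<open>unary\<close>, while \<open>pad\<close> limits the numbers of states.
  \<open>Br Leaf\<close> in front of the budget and of the target adds 1.\<close>

definition accept :: "bt \<Rightarrow> bt \<Rightarrow> bt \<Rightarrow> bool" where
  "accept pad p x \<longleftrightarrow>
    (\<exists>s\<in>set (list_of (search pad (branch p)
        (Br (Br p (Br Leaf (unary p (left (right x))))) (Br Leaf Leaf)) (right (left x)))).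
      good pad (Br Leaf (unary p (right (right x)))) s)"

lemma ptime_search_branch:
  assumes "ptime P" "ptime Q" "ptime A" "ptime L"
  shows "ptime (\<lambda>x. search (P x) (branch (Q x)) (A x) (L x))"
proof (rule ptime_search[where f = "\<lambda>x. branch (Q x)" and b = "\<lambda>x. nodes (L x) + 20"])
  show "ptime (\<lambda>y. branch (Q (left y)) (left (right y)) (right (right y)))"
    by (intro ptime_branch ptime_compose[OF assms(2)] ptime_intros)
  show "poly_in nodes (\<lambda>x. nodes (L x) + 20)"
    by (intro poly_in_add poly_in_const ptime_inD assms)
  fix x e s c
  assume "e \<in> set (list_of (L x))" "c \<in> set (list_of (branch (Q x) e s))"
  then show "nodes c \<le> nodes s + (nodes (L x) + 20)"
    using nodes_branch nodes_member_le by fastforce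
qed (fact assms)+

lemma ptime_search_extend:
  assumes "ptime P" "ptime A" "ptime L"
  shows "ptime (\<lambda>x. search (P x) extend_matching (A x) (L x))"
proof (rule ptime_search[where f = "\<lambda>x. extend_matching" and b = "\<lambda>x. nodes (L x) + 20"])
  show "ptime (\<lambda>y. extend_matching (left (right y)) (right (right y)))"
    by (intro ptime_extend_matching ptime_intros)
  show "poly_in nodes (\<lambda>x. nodes (L x) + 20)"
    by (intro poly_in_add poly_in_const ptime_inD assms)
  fix x :: bt and e s c
  assume "e \<in> set (list_of (L x))" "c \<in> set (list_of (extend_matching e s))"
  then show "nodes c \<le> nodes s + (nodes (L x) + 20)"
    using nodes_extend_matching nodes_member_le by fastforce
qed (fact assms)+

lemma pdec_good:
  assumes "ptime P" "ptime M" "ptime S"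
  shows "pdec (\<lambda>x. good (P x) (M x) (S x))"
  unfolding good_def
  by (intro pdec_conj pdec_not pdec_eq_Leaf pdec_ball ptime_search_extend ptime_shorten ptime_intros assms)

lemma pdec_accept:
  assumes "ptime P" "ptime Q" "ptime X"
  shows "pdec (\<lambda>x. accept (P x) (Q x) (X x))"
  unfolding accept_def
proof (rule pdec_bex)
  show "pdec (\<lambda>y. good (P (left y)) (Br Leaf (unary (Q (left y)) (right (right (X (left y)))))) (right y))"
    by (intro pdec_good ptime_unary ptime_intros ptime_compose[OF assms(1)] ptime_compose[OF assms(2)]
      ptime_compose[OF assms(3)])
qed (intro ptime_search_branch ptime_unary ptime_intros assms)

section \<open>Exponentially long lists by repeated doubling\<close>

definition pow2 :: "bt \<Rightarrow> bt" where
  "pow2 x = foldl (\<lambda>a e. push a a) (Br Leaf Leaf) (list_of x)"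

lemma pow2_fold: "foldl (\<lambda>a e. push a a) (enc_unary n) es = enc_unary (2 ^ length es * n)"
  by (induction es arbitrary: n) (simp_all add: push_unary mult_2 algebra_simps)

lemma pow2_eq: "pow2 x = enc_unary (2 ^ length (list_of x))"
proof -
  have "Br Leaf Leaf = enc_unary 1" by (simp add: enc_unary_def enc_list_def)
  then show ?thesis by (simp add: pow2_def pow2_fold)
qed

text \<open>The measure contains the length of the result; all intermediate lists are at most as
  long.\<close>

lemma ptime_in_pow2: "ptime_in (\<lambda>x. nodes x + 2 ^ length (list_of x)) pow2"
proof -
  let ?Z = "\<lambda>x. nodes x + 2 ^ length (list_of x)"
  have u: "Br Leaf Leaf = enc_unary 1" by (simp add: enc_unary_def enc_list_def)
  have 1: "ptime (\<lambda>y. push (left (right y)) (left (right y)))"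
    by (intro ptime_push ptime_intros)
  have 2: "poly_in ?Z (\<lambda>x. 2 * ?Z x + 1)"
    by (intro poly_in_add poly_in_mult[of _ "\<lambda>_. 2"] poly_in_const poly_in_self)
  have "nodes (foldl (\<lambda>a e. push a a) (Br Leaf Leaf) ys) \<le> 2 * ?Z x + 1"
    if "list_of x = ys @ zs" for x ys zs
  proof -
    have "(2 :: nat) ^ length ys \<le> 2 ^ length (list_of x)"
      by (rule power_increasing) (simp_all add: that)
    then show ?thesis
      unfolding u pow2_fold nodes_unary mult_1_right by (intro add_mono mult_left_mono trans_le_add2) simp_all
  qed
  from ptime_fold_bounded[where step = "\<lambda>x a e. push a a" and A = "\<lambda>x. Br Leaf Leaf" and L = "\<lambda>x. x",
      OF 1 _ ptime_id 2 _ this]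
  show ?thesis unfolding pow2_def by (simp add: ptime_intros)
qed

section \<open>Matchings\<close>

lemma card_Union_edges_le:
  assumes "finite M" "\<forall>e\<in>M. card e = 2"
  shows "finite (\<Union>M)" "card (\<Union>M) \<le> 2 * card M"
proof -
  show "finite (\<Union>M)" using assms by (intro finite_Union) (auto intro: card_ge_0_finite)
  have "card (\<Union>M) \<le> sum card M" by (rule card_Union_le_sum_card)
  also have "\<dots> = 2 * card M" using assms by simp
  finally show "card (\<Union>M) \<le> 2 * card M" .
qed

lemma disjoint_insert_edge:
  "disjoint M \<Longrightarrow> e \<inter> \<Union>M = {} \<Longrightarrow> disjoint (insert e M)"
  unfolding disjoint_def by blast

text \<open>
  Greedy choice: fewer than \<open>2 |M| + 2 |W|\<close> vertices are forbidden as the partner of the next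
  vertex of \<open>W\<close>, namely those covered by \<open>M\<close> and the rest of \<open>W\<close>.
\<close>

lemma matching_high_degree:
  assumes "finite W" "finite H" "\<forall>e\<in>H. card e = 2" "matching H M" "W \<inter> \<Union>M = {}"
    and "\<forall>w\<in>W. 2 * card M + 2 * card W \<le> card {e\<in>H. w \<in> e}"
  shows "\<exists>M'. matching H M' \<and> card M' = card M + card W"
  using assms
proof (induction W arbitrary: M rule: finite_induct)
  case (insert w W)
  let ?X = "\<Union>M \<union> W"
  let ?D = "{e\<in>H. w \<in> e}"
  have M: "finite M" "\<forall>e\<in>M. card e = 2"
    using insert.prems by (auto simp: matching_def intro: finite_subset)
  have X: "finite ?X" "card ?X \<le> 2 * card M + card W"
    using card_Union_edges_le[OF M] insert.hyps card_Un_le[of "\<Union>M" W] by auto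
  \<comment> \<open>Otherwise the degree of \<open>w\<close> would be at most
    \<open>2 |M| + |W|\<close>, which is too small.\<close>
  have "\<not> ?D \<subseteq> (\<lambda>x. {w, x}) ` ?X"
  proof
    assume "?D \<subseteq> (\<lambda>x. {w, x}) ` ?X"
    then have "card ?D \<le> card ?X"
      using X(1) by (meson card_image_le card_mono finite_imageI order_trans)
    then show False using X(2) insert by fastforce
  qed
  then obtain e where e: "e \<in> H" "w \<in> e" "e \<notin> (\<lambda>x. {w, x}) ` ?X" by blast
  have "card e = 2" using e insert.prems by blast
  then obtain a b where ab: "e = {a, b}" "a \<noteq> b" by (auto simp: card_2_iff)
  have w: "w \<notin> ?X" using insert by auto
  have "e \<inter> ?X = {}" using e(2,3) w unfolding ab by (auto simp: insert_commute)
  then have 1: "matching H (insert e M)" "W \<inter> \<Union>(insert e M) = {}" "e \<notin> M"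
    using insert.prems e disjoint_insert_edge[of M e] by (auto simp: matching_def)
  then have c: "card (insert e M) = Suc (card M)" using M by simp
  \<comment> \<open>One vertex of \<open>W\<close> has been traded for one edge of \<open>M\<close>,
    so \<open>2 |M| + 2 |W|\<close> is unchanged and the degree hypothesis carries over.\<close>
  have "\<exists>M'. matching H M' \<and> card M' = card (insert e M) + card W"
    by (rule insert.IH) (use insert.prems insert.hyps 1 c in auto)
  then show ?case using c insert.hyps by simp
qed auto

lemma matching_bound_cover:
  assumes H: "finite H" "\<forall>e\<in>H. card e = 2" and m: "\<And>M. matching H M \<Longrightarrow> card M \<le> m"
  obtains U F where "finite U" "F \<subseteq> H" "\<And>e. e \<in> H \<Longrightarrow> e \<inter> U \<noteq> {} \<or> e \<in> F"
    "card F \<le> 2 * m * (2 * m + 1)" "\<And>M. matching F M \<Longrightarrow> card U + card M \<le> m"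
proof
  define U where "U = {v. 2 * m + 2 \<le> card {e\<in>H. v \<in> e}}"
  define F where "F = {e\<in>H. e \<inter> U = {}}"
  have "U \<subseteq> \<Union>H"
  proof
    fix v assume "v \<in> U"
    then have "card {e\<in>H. v \<in> e} \<noteq> 0" by (simp add: U_def)
    then have "{e\<in>H. v \<in> e} \<noteq> {}" by (metis card.empty)
    then show "v \<in> \<Union>H" by blast
  qed
  then show U: "finite U" using card_Union_edges_le(1)[OF H] finite_subset by blast
  show "F \<subseteq> H" "\<And>e. e \<in> H \<Longrightarrow> e \<inter> U \<noteq> {} \<or> e \<in> F"
    by (auto simp: F_def)
  have F: "finite F" using H(1) by (simp add: F_def)
  show "card U + card M \<le> m" if M: "matching F M" for M
  proof (rule ccontr)
    assume "\<not> card U + card M \<le> m"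
    moreover have MH: "matching H M" using M by (auto simp: matching_def F_def)
    moreover have Mm: "card M \<le> m" by (rule m) (rule MH)
    \<comment> \<open>\<open>W\<close> is chosen with \<open>|M| + |W| = m + 1\<close>: then the
      degree required by the greedy argument is exactly the threshold \<open>2 m + 2\<close>, and
      the extended matching is too large by one edge.\<close>
    ultimately have "m + 1 - card M \<le> card U" by simp
    then obtain W where W: "W \<subseteq> U" "card W = m + 1 - card M" "finite W"
      by (rule obtain_subset_with_card_n)
    have "W \<inter> \<Union>M = {}" using M W(1) by (auto simp: matching_def F_def)
    moreover have "\<forall>w\<in>W. 2 * card M + 2 * card W \<le> card {e\<in>H. w \<in> e}"
      using W Mm by (auto simp: U_def)
    ultimately obtain M' where "matching H M'" "card M' = card M + card W"
      using matching_high_degree[OF W(3) H MH] by blast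
    then show False using m[of M'] W(2) Mm by simp
  qed
  obtain M where M: "matching F M" and max: "\<And>M'. matching F M' \<Longrightarrow> card M' \<le> card M"
  proof -
    have "matching F {}" by (simp add: matching_def)
    moreover have "\<forall>M. matching F M \<longrightarrow> card M < Suc (card F)"
      using F by (auto simp: matching_def less_Suc_eq_le intro: card_mono)
    ultimately have "\<exists>M. matching F M \<and> (\<forall>M'. matching F M' \<longrightarrow> card M' \<le> card M)"
      by (rule ex_has_greatest_nat)
    then show ?thesis using that by blast
  qed
  have MH: "matching H M" using M by (auto simp: matching_def F_def)
  have fM: "finite M" "\<forall>e\<in>M. card e = 2" using MH H by (auto simp: matching_def intro: finite_subset)
  \<comment> \<open>An edge of \<open>F\<close> disjoint from the largest matching \<open>M\<close>
    could be added to it.\<close>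
  have "e \<inter> \<Union>M \<noteq> {}" if e: "e \<in> F" for e
  proof
    assume d: "e \<inter> \<Union>M = {}"
    have "e \<noteq> {}" using e H(2) by (auto simp: F_def)
    then have "e \<notin> M" using d by blast
    moreover have "matching F (insert e M)" using M e disjoint_insert_edge[OF _ d] by (auto simp: matching_def)
    ultimately show False using max[of "insert e M"] fM by simp
  qed
  then have "\<exists>v\<in>\<Union>M. v \<in> e" if "e \<in> F" for e using that by blast
  then have "F \<subseteq> (\<Union>v\<in>\<Union>M. {e\<in>H. v \<in> e})"
    by (intro subsetI) (simp add: F_def)
  then have "card F \<le> card (\<Union>v\<in>\<Union>M. {e\<in>H. v \<in> e})"
    using H(1) card_Union_edges_le(1)[OF fM] by (intro card_mono finite_UN_I) simp_all
  also have "\<dots> \<le> (\<Sum>v\<in>\<Union>M. card {e\<in>H. v \<in> e})"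
    by (rule card_UN_le) (rule card_Union_edges_le(1)[OF fM])
  also have "\<dots> \<le> (\<Sum>v\<in>\<Union>M. 2 * m + 1)"
  proof (rule sum_mono)
    fix v assume "v \<in> \<Union>M"
    then have "v \<notin> U" using M by (auto simp: matching_def F_def)
    then show "card {e\<in>H. v \<in> e} \<le> 2 * m + 1" by (simp add: U_def)
  qed
  also have "\<dots> = card (\<Union>M) * (2 * m + 1)" by simp
  also have "\<dots> \<le> 2 * m * (2 * m + 1)"
    using card_Union_edges_le(2)[OF fM] m[OF MH] by (intro mult_right_mono) simp_all
  finally show "card F \<le> 2 * m * (2 * m + 1)" .
qed

text \<open>Matching edges that meet \<open>U\<close> have distinct representatives in
  \<open>U\<close> by disjointness; the remaining ones form a matching of \<open>F\<close>.\<close>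

lemma card_matching_le:
  assumes "finite U" "finite H" "\<And>e. e \<in> H \<Longrightarrow> e \<inter> U \<noteq> {} \<or> e \<in> F"
    and "\<And>M. matching F M \<Longrightarrow> card U + card M \<le> m" and M: "matching H M"
  shows "card M \<le> m"
proof -
  let ?A = "{e\<in>M. e \<inter> U \<noteq> {}}"
  have fin: "finite M" using M assms(2) by (auto simp: matching_def intro: finite_subset)
  obtain h where h: "\<And>e. e \<in> ?A \<Longrightarrow> h e \<in> e \<inter> U"
    using bchoice[of ?A "\<lambda>e x. x \<in> e \<inter> U"] by blast
  have "inj_on h ?A"
  proof (rule inj_onI)
    fix e f assume ef: "e \<in> ?A" "f \<in> ?A" "h e = h f"
    then have "h e \<in> e \<inter> f" using h[of e] h[of f] by simp
    then show "e = f" using M ef by (auto simp: matching_def disjoint_def)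
  qed
  then have "card ?A \<le> card U" using h assms(1) by (intro card_inj_on_le[of h]) auto
  moreover have "card U + card (M - ?A) \<le> m"
    by (rule assms(4)) (use M assms(3) in \<open>auto simp: matching_def disjoint_def\<close>)
  moreover have "card M = card ?A + card (M - ?A)"
    using card_Un_disjoint[of ?A "M - ?A"] fin by (simp add: Un_absorb1)
  ultimately show ?thesis by simp
qed

text \<open>Unit weights enter here: they turn the weight of a matching into its
  cardinality.\<close>

lemma nu_le_iff:
  assumes "finite E" "\<forall>e\<in>E. w e = 1"
  shows "nu E w \<le> m \<longleftrightarrow> (\<forall>M. matching E M \<longrightarrow> card M \<le> m)"
proof -
  have "sum w M = card M" if "matching E M" for M
    using that assms(2) by (subst card_eq_sum, intro sum.cong) (auto simp: matching_def)
  then have eq: "{sum w M | M. matching E M} = card ` {M. matching E M}"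
    by (auto simp: image_def) metis
  have "finite {M. matching E M}"
    by (rule finite_subset[of _ "Pow E"]) (use assms(1) in \<open>auto simp: matching_def\<close>)
  moreover have "{} \<in> {M. matching E M}" by (simp add: matching_def)
  ultimately show ?thesis unfolding nu_def eq by (subst Max_le_iff) auto
qed

section \<open>Correctness\<close>

definition ends :: "'v \<times> 'v \<Rightarrow> 'v set" where
  "ends = (\<lambda>(u, v). {u, v})"

lemma ends_Pair [simp]: "ends (u, v) = {u, v}"
  by (simp add: ends_def)

type_synonym state = "(nat \<times> nat) list \<times> nat list \<times> (nat \<times> nat) list"

text \<open>Deleted edges, covering vertices and kept edges; \<open>n\<close> bounds their total number.\<close>

fun decide_edge :: "nat \<Rightarrow> nat \<times> nat \<Rightarrow> state \<Rightarrow> state list" where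
  "decide_edge n (u, v) (I, U, F) =
    (if u \<in> set U \<or> v \<in> set U then [(I, U, F)]
     else if n \<le> length I + length U + length F then []
     else [((u, v) # I, U, F), (I, u # U, F), (I, v # U, F), (I, U, (u, v) # F)])"

definition add_edge :: "'v \<times> 'v \<Rightarrow> ('v \<times> 'v) list \<Rightarrow> ('v \<times> 'v) list list" where
  "add_edge e M = (if ends e \<inter> \<Union>(ends ` set M) \<noteq> {} then [M] else [M, e # M])"

text \<open>Subtraction on naturals agrees with \<open>shorten\<close>: the second counter is 0
  exactly if the deleted edges cost more than the budget.\<close>

fun enc_state :: "mmei \<Rightarrow> nat \<Rightarrow> state \<Rightarrow> bt" where
  "enc_state G n (I, U, F) =
    Br (Br (enc_unary (n - (length I + length U + length F)))
         (enc_unary (Suc (budget G) - sum_list (map (cost G \<circ> ends) I))))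
      (Br (enc_list (map enc_nat U)) (enc_list (map (enc_edge G) F)))"

definition enc_matching :: "nat \<Rightarrow> (nat \<times> nat) list \<Rightarrow> bt" where
  "enc_matching n M = Br (enc_unary (n - length M))
     (enc_list (concat (map (\<lambda>(u, v). [enc_nat u, enc_nat v]) M)))"

lemma touches_enc: "touches (enc_nat u) (enc_nat v) (enc_list (map enc_nat U)) \<longleftrightarrow> u \<in> set U \<or> v \<in> set U"
  by (auto simp: touches_def digits_eq_enc_nat)

lemma enc_list_Cons: "enc_list (x # xs) = Br x (enc_list xs)"
  by (simp add: enc_list_def)

text \<open>A cost that \<open>unary\<close> does not represent exactly comes out as at least the
  length of \<open>p\<close>, hence above the budget; the budget counter then drops to 0 just as for
  the true cost.\<close>

lemma branch_enc:
  assumes "budget G < length (list_of p)"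
  shows "list_of (branch p (enc_edge G e) (enc_state G n s)) = map (enc_state G n) (decide_edge n e s)"
proof -
  obtain u v I U F where es: "e = (u, v)" "s = (I, U, F)" by (metis prod_cases3 surj_pair)
  obtain c where c: "unary p (enc_nat (cost G {u, v})) = enc_unary c"
    "min (cost G {u, v}) (length (list_of p)) \<le> c" "c \<le> cost G {u, v}"
    by (rule unary_enc_nat)
  have "Suc (budget G) - k - c = Suc (budget G) - (cost G {u, v} + k)" for k
    using c(2,3) assms by (auto simp: min_def split: if_splits)
  then show ?thesis
    by (simp add: es branch_def enc_edge_def touches_enc right_unary shorten_unary c(1) enc_list_Cons)
qed

lemma extend_enc:
  "list_of (extend_matching (enc_edge G e) (enc_matching n M)) = map (enc_matching n) (add_edge e M)"
proof -
  obtain u v where e: "e = (u, v)" by fastforce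
  have "enc_list (concat (map (\<lambda>(u, v). [enc_nat u, enc_nat v]) M)) =
      enc_list (map enc_nat (concat (map (\<lambda>(u, v). [u, v]) M)))"
    by (rule arg_cong[of _ _ enc_list], induction M) auto
  moreover have "set (concat (map (\<lambda>(u, v). [u, v]) M)) = \<Union>(ends ` set M)"
    by (induction M) auto
  ultimately have t: "touches (enc_nat u) (enc_nat v) (enc_list (concat (map (\<lambda>(u, v). [enc_nat u, enc_nat v]) M)))
      \<longleftrightarrow> ends e \<inter> \<Union>(ends ` set M) \<noteq> {}"
    unfolding e by (simp only: touches_enc) auto
  show ?thesis
  proof (cases "ends e \<inter> \<Union>(ends ` set M) = {}")
    case True
    then have "add_edge e M = [M, e # M]" by (simp add: add_edge_def)
    then show ?thesis using t True
      by (simp add: extend_matching_def enc_matching_def enc_edge_def e right_unary enc_list_Cons)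
  next
    case False
    then have "add_edge e M = [M]" by (simp add: add_edge_def)
    then show ?thesis using t False
      by (simp add: extend_matching_def enc_matching_def enc_edge_def e)
  qed
qed

text \<open>Transfers a simulation of single steps to whole search trees.\<close>

lemma paths_map:
  "(\<And>e s. e \<in> set es \<Longrightarrow> f (k e) (h s) = map h (g e s)) \<Longrightarrow> paths f (map k es) (h s) = map h (paths g es s)"
proof (induction es arbitrary: s)
  case (Cons e es)
  then show ?case by (simp add: map_concat comp_def)
qed simp

lemma set_search_branch:
  assumes "budget G < length (list_of p)" "4 ^ n \<le> length (list_of pad)"
  shows "set (list_of (search pad (branch p) (enc_state G n ([], [], [])) (enc_list (map (enc_edge G) es)))) =
    enc_state G n ` set (paths (decide_edge n) es ([], [], []))"
proof -
  \<comment> \<open>A branching replaces a state by four states with one unit less of fuel, so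
    \<open>4 ^ fuel\<close> does not increase.\<close>
  let ?w = "\<lambda>(_ :: bt list) s. 4 ^ length (list_of (left (left s))) :: nat"
  have "sum_list (map (?w es) (list_of (branch p e s))) \<le> ?w (e # es) s" for e es s
    by (cases "left (left s)") (simp_all add: branch_def)
  then have "set (list_of (search pad (branch p) (enc_state G n ([], [], [])) (enc_list (map (enc_edge G) es)))) =
    set (paths (\<lambda>e s. list_of (branch p e s)) (map (enc_edge G) es) (enc_state G n ([], [], [])))"
    using set_search[of ?w "enc_list (map (enc_edge G) es)" "branch p" "enc_state G n ([], [], [])" pad] assms(2)
    by (simp add: list_of_Leaves)
  also have "\<dots> = enc_state G n ` set (paths (decide_edge n) es ([], [], []))"
    by (subst paths_map[where g = "decide_edge n"]) (simp_all add: branch_enc[OF assms(1)])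
  finally show ?thesis .
qed

lemma set_search_extend:
  assumes "2 ^ length F \<le> length (list_of pad)"
  shows "set (list_of (search pad extend_matching (enc_matching n []) (enc_list (map (enc_edge G) F)))) =
    enc_matching n ` set (paths add_edge F [])"
proof -
  \<comment> \<open>Each remaining edge at most doubles the number of states.\<close>
  let ?w = "\<lambda>es (s :: bt). 2 ^ length es :: nat"
  have "sum_list (map (?w es) (list_of (extend_matching e s))) \<le> ?w (e # es) s" for e s and es :: "bt list"
    by (simp add: extend_matching_def)
  then have "set (list_of (search pad extend_matching (enc_matching n []) (enc_list (map (enc_edge G) F)))) =
    set (paths (\<lambda>e s. list_of (extend_matching e s)) (map (enc_edge G) F) (enc_matching n []))"
    using set_search[of ?w "enc_list (map (enc_edge G) F)" extend_matching "enc_matching n []" pad] assms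
    by simp
  also have "\<dots> = enc_matching n ` set (paths add_edge F [])"
    by (subst paths_map[where g = add_edge]) (simp_all add: extend_enc)
  finally show ?thesis .
qed

section \<open>Enumeration of matchings\<close>

text \<open>An edge is added only if it avoids the vertices already covered; hence it is also new,
  and the length of the list is the cardinality of the matching.\<close>

lemma paths_add_edge_sound:
  assumes "M \<in> set (paths add_edge F M0)" "disjoint (ends ` set M0)" "card (ends ` set M0) = length M0"
  shows "ends ` set M \<subseteq> ends ` set M0 \<union> ends ` set F \<and> disjoint (ends ` set M) \<and> card (ends ` set M) = length M"
  using assms
proof (induction F arbitrary: M0)
  case (Cons e F)
  then obtain M1 where M1: "M1 \<in> set (add_edge e M0)" "M \<in> set (paths add_edge F M1)" by auto
  show ?case
  proof (cases "M1 = M0")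
    case True
    then have "M \<in> set (paths add_edge F M0)" using M1(2) by simp
    from Cons.IH[OF this Cons.prems(2,3)] show ?thesis by auto
  next
    case False
    then have M1e: "M1 = e # M0" and d: "ends e \<inter> \<Union>(ends ` set M0) = {}"
      using M1(1) by (auto simp: add_edge_def split: if_splits)
    have ne: "ends e \<noteq> {}" by (cases e) simp
    have "ends e \<notin> ends ` set M0"
    proof
      assume "ends e \<in> ends ` set M0"
      then have "ends e \<subseteq> \<Union>(ends ` set M0)" by (rule Union_upper)
      then show False using d ne by (simp only: Int_absorb2)
    qed
    then have "card (insert (ends e) (ends ` set M0)) = Suc (length M0)"
      using Cons.prems(3) by (metis card_insert_disjoint finite_imageI List.finite_set)
    then have c: "card (ends ` set M1) = length M1" unfolding M1e by simp
    have "disjoint (ends ` set M1)"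
      using disjoint_insert_edge[OF Cons.prems(2) d] by (simp add: M1e)
    from Cons.IH[OF M1(2) this c] show ?thesis by (auto simp: M1e)
  qed
qed simp

lemma disjoint_remove:
  assumes "disjoint N" "e \<in> N" "\<Union>N \<inter> X = {}"
  shows "disjoint (N - {e})" "\<Union>(N - {e}) \<inter> (e \<union> X) = {}" "e \<inter> X = {}"
  using assms by (auto simp: disjoint_def)

text \<open>The path to \<open>N\<close> takes an edge exactly if it lies in the part of
  \<open>N\<close> still to be collected. Removing it from that part also deals with repetitions in
  \<open>F\<close>.\<close>

lemma paths_add_edge_complete:
  assumes "N \<subseteq> ends ` set F" "disjoint N" "\<Union>N \<inter> \<Union>(ends ` set M0) = {}"
  shows "\<exists>M\<in>set (paths add_edge F M0). length M = length M0 + card N"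
  using assms
proof (induction F arbitrary: N M0)
  case (Cons e F)
  have fin: "finite N" using Cons.prems(1) finite_subset by blast
  have sub: "N - {ends e} \<subseteq> ends ` set F"
    using Cons.prems(1) by (simp only: list.set image_insert Diff_subset_conv insert_is_Un[symmetric])
  show ?case
  proof (cases "ends e \<in> N")
    case True
    note r = disjoint_remove[OF Cons.prems(2) True Cons.prems(3)]
    have "\<exists>M\<in>set (paths add_edge F (e # M0)). length M = length (e # M0) + card (N - {ends e})"
      by (rule Cons.IH[OF sub r(1)]) (simp only: list.set image_insert Union_insert r(2))
    then obtain M where M: "M \<in> set (paths add_edge F (e # M0))" "length M = length (e # M0) + card (N - {ends e})"
      by (rule bexE)
    have "length M = length M0 + card N"
      using M(2) card_Suc_Diff1[OF fin True] by (simp del: card_Diff_insert)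
    moreover have "e # M0 \<in> set (add_edge e M0)"
      unfolding add_edge_def r(3) by simp
    then have "M \<in> set (paths add_edge (e # F) M0)"
      using M(1) by (simp only: paths.simps set_concat set_map) (rule UN_I[OF imageI], assumption+)
    ultimately show ?thesis by (rule bexI)
  next
    case False
    then have "N \<subseteq> ends ` set F"  using Cons.prems(1) by auto
    from Cons.IH[OF this Cons.prems(2,3)]
    have "\<exists>M\<in>set (paths add_edge F M0). length M = length M0 + card N" .
    moreover have "M0 \<in> set (add_edge e M0)" by (simp add: add_edge_def)
    ultimately show ?thesis by auto
  qed
qed simp

text \<open>With the padding assumed, no state is lost, so the test runs over all matchings of
  \<open>F\<close>.\<close>

lemma good_enc:
  assumes "2 ^ length F \<le> length (list_of pad)"
  shows "good pad (enc_unary (Suc m)) (enc_state G n (I, U, F)) \<longleftrightarrow>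
    sum_list (map (cost G \<circ> ends) I) \<le> budget G \<and>
    (\<forall>M. matching (ends ` set F) M \<longrightarrow> length U + card M \<le> m)"
proof -
  have shorten: "shorten (enc_list (map enc_nat U)) (enc_unary (Suc m)) = enc_unary (Suc m - length U)"
    by (rule list_of_eqI) (simp add: list_of_shorten list_of_Leaves del: replicate_Suc)
  have initial: "enc_matching k [] = Br (enc_unary k) Leaf" for k
    by (simp add: enc_matching_def enc_list_def)
  have left_eq: "left (enc_matching k M) = Leaf \<longleftrightarrow> k \<le> length M" for k M
    by (simp add: enc_matching_def)
  have "good pad (enc_unary (Suc m)) (enc_state G n (I, U, F)) \<longleftrightarrow>
    sum_list (map (cost G \<circ> ends) I) \<le> budget G \<and>
    (\<forall>M\<in>set (paths add_edge F []). length U + length M \<le> m)"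
    using set_search_extend[OF assms, of "Suc m - length U" G]
    by (auto simp: good_def shorten initial left_eq Suc_diff_le)
  moreover have "(\<forall>M\<in>set (paths add_edge F []). length U + length M \<le> m) \<longleftrightarrow>
      (\<forall>M. matching (ends ` set F) M \<longrightarrow> length U + card M \<le> m)"
  proof (intro iffI allI ballI impI)
    fix M assume a: "\<forall>M\<in>set (paths add_edge F []). length U + length M \<le> m" "matching (ends ` set F) M"
    then show "length U + card M \<le> m"
      using paths_add_edge_complete[of M F "[]"] by (auto simp: matching_def)
  next
    fix M assume a: "\<forall>M. matching (ends ` set F) M \<longrightarrow> length U + card M \<le> m" "M \<in> set (paths add_edge F [])"
    show "length U + length M \<le> m"
      using paths_add_edge_sound[OF a(2)] a(1) by (auto simp: matching_def)
  qed
  ultimately show ?thesis by blast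
qed

section \<open>Soundness and completeness of the branching on edges\<close>

text \<open>The three lists only grow along a path, so an edge settled when it is read stays
  settled. Distinctness makes the cost of \<open>I\<close> a sum over a set, and the length bound
  limits the later enumeration of matchings of \<open>F\<close>.\<close>

lemma paths_decide_edge_sound:
  assumes "(I, U, F) \<in> set (paths (decide_edge n) es (I0, U0, F0))"
    and "distinct (map ends (I0 @ es))" "length I0 + length U0 + length F0 \<le> n"
  shows "distinct (map ends I) \<and> set I \<subseteq> set I0 \<union> set es \<and>
    set I0 \<subseteq> set I \<and> set U0 \<subseteq> set U \<and> set F0 \<subseteq> set F \<and> length I + length U + length F \<le> n \<and>
    (\<forall>e\<in>set es. e \<in> set I \<or> ends e \<inter> set U \<noteq> {} \<or> e \<in> set F)"
  using assms
proof (induction es arbitrary: I0 U0 F0)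
  case (Cons e es)
  obtain u v where e: "e = (u, v)" by fastforce
  obtain I1 U1 F1 where s: "(I1, U1, F1) \<in> set (decide_edge n e (I0, U0, F0))"
    "(I, U, F) \<in> set (paths (decide_edge n) es (I1, U1, F1))"
    using Cons.prems(1) by auto
  have 1: "set I1 \<subseteq> insert e (set I0)" "set I0 \<subseteq> set I1" "set U0 \<subseteq> set U1" "set F0 \<subseteq> set F1"
    "length I1 + length U1 + length F1 \<le> n"
    "e \<in> set I1 \<or> ends e \<inter> set U1 \<noteq> {} \<or> e \<in> set F1"
    using s(1) Cons.prems(3) by (auto simp: e split: if_splits)
  have "I1 = I0 \<or> I1 = e # I0" using s(1) by (auto simp: e split: if_splits)
  then have d: "distinct (map ends (I1 @ es))"
    using Cons.prems(2) by (elim disjE) simp_all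
  have ih: "distinct (map ends I)" "set I \<subseteq> set I1 \<union> set es" "set I1 \<subseteq> set I" "set U1 \<subseteq> set U"
    "set F1 \<subseteq> set F" "length I + length U + length F \<le> n"
    "\<forall>e\<in>set es. e \<in> set I \<or> ends e \<inter> set U \<noteq> {} \<or> e \<in> set F"
    using Cons.IH[OF s(2) d 1(5)] by blast+
  have "e \<in> set I \<or> ends e \<inter> set U \<noteq> {} \<or> e \<in> set F" using ih(3-5) 1(6) by blast
  moreover have "set I \<subseteq> set I0 \<union> set (e # es)" using ih(2) 1(1) by auto
  moreover have "set I0 \<subseteq> set I" "set U0 \<subseteq> set U" "set F0 \<subseteq> set F" using ih(3-5) 1(2-4) by blast+
  ultimately show ?case using ih by simp
qed auto

lemma distinct_length_le: "distinct xs \<Longrightarrow> set xs \<subseteq> A \<Longrightarrow> finite A \<Longrightarrow> length xs \<le> card A"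
  by (metis card_mono distinct_card)

text \<open>\<open>X\<close>, \<open>Y\<close> and \<open>Z\<close> guide the path: at each edge
  that requires a decision, one of the four branches adds a new element of the corresponding set.
  Thus at most \<open>card X + card Y + card Z\<close> units of fuel are spent.\<close>

lemma paths_decide_edge_complete:
  assumes fin: "finite X" "finite Y" "finite Z" and n: "card X + card Y + card Z \<le> n"
    and "set I0 \<subseteq> X" "set U0 \<subseteq> Y" "set F0 \<subseteq> Z" "distinct I0" "distinct U0" "distinct F0"
    and "distinct es" "set es \<inter> (set I0 \<union> set F0) = {}"
    and "\<forall>e\<in>set es. e \<in> X \<or> ends e \<inter> Y \<noteq> {} \<or> e \<in> Z"
  shows "\<exists>I U F. (I, U, F) \<in> set (paths (decide_edge n) es (I0, U0, F0)) \<and>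
    set I \<subseteq> X \<and> set U \<subseteq> Y \<and> set F \<subseteq> Z \<and> distinct I \<and> distinct U"
  using assms(5-)
proof (induction es arbitrary: I0 U0 F0)
  case Nil
  then show ?case by auto
next
  case (Cons e es)
  obtain u v where e: "e = (u, v)" by fastforce
  have le: "length I0 \<le> card X" "length U0 \<le> card Y" "length F0 \<le> card Z"
    using Cons.prems fin by (simp_all add: distinct_length_le)
  have step: ?case if s: "(I1, U1, F1) \<in> set (decide_edge n e (I0, U0, F0))"
    and ex: "\<exists>I U F. (I, U, F) \<in> set (paths (decide_edge n) es (I1, U1, F1)) \<and>
      set I \<subseteq> X \<and> set U \<subseteq> Y \<and> set F \<subseteq> Z \<and> distinct I \<and> distinct U" for I1 U1 F1
  proof -
    obtain I U F where IUF: "(I, U, F) \<in> set (paths (decide_edge n) es (I1, U1, F1))"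
      "set I \<subseteq> X \<and> set U \<subseteq> Y \<and> set F \<subseteq> Z \<and> distinct I \<and> distinct U"
      using ex by blast
    have "(I, U, F) \<in> set (paths (decide_edge n) (e # es) (I0, U0, F0))"
      using s IUF(1) by auto
    then show ?thesis using IUF(2) by blast
  qed
  show ?case
  proof (cases "u \<in> set U0 \<or> v \<in> set U0")
    case True
    then show ?thesis using Cons.IH[of I0 U0 F0] Cons.prems by (simp add: e)
  next
    case False
    consider "e \<in> X" | "u \<in> Y" | "v \<in> Y" | "e \<in> Z" using Cons.prems(9) by (auto simp: e)
    then show ?thesis
    proof cases
      case 1
      \<comment> \<open>The enlarged list still fits into \<open>X\<close>, so fuel is left for this
        branching; the other three cases are alike.\<close>
      have "length (e # I0) \<le> card X"
        by (rule distinct_length_le) (use Cons.prems 1 fin in auto)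
      then have "length I0 + length U0 + length F0 < n" using le n by simp
      then show ?thesis
        by (intro step[of "e # I0" U0 F0] Cons.IH) (use Cons.prems 1 False in \<open>simp_all add: e\<close>)
    next
      case 2
      have "length (u # U0) \<le> card Y"
        by (rule distinct_length_le) (use Cons.prems 2 fin False in auto)
      then have "length I0 + length U0 + length F0 < n" using le n by simp
      then show ?thesis
        by (intro step[of I0 "u # U0" F0] Cons.IH) (use Cons.prems 2 False in \<open>simp_all add: e\<close>)
    next
      case 3
      have "length (v # U0) \<le> card Y"
        by (rule distinct_length_le) (use Cons.prems 3 fin False in auto)
      then have "length I0 + length U0 + length F0 < n" using le n by simp
      then show ?thesis
        by (intro step[of I0 "v # U0" F0] Cons.IH) (use Cons.prems 3 False in \<open>simp_all add: e\<close>)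
    next
      case 4
      have "length (e # F0) \<le> card Z"
        by (rule distinct_length_le) (use Cons.prems 4 fin in auto)
      then have "length I0 + length U0 + length F0 < n" using le n by simp
      then show ?thesis
        by (intro step[of I0 U0 "e # F0"] Cons.IH) (use Cons.prems 4 False in \<open>simp_all add: e\<close>)
    qed
  qed
qed

lemma unary_enc_nat_exact:
  assumes "n \<le> length (list_of p)"
  shows "unary p (enc_nat n) = enc_unary n"
proof -
  obtain v where "unary p (enc_nat n) = enc_unary v" "min n (length (list_of p)) \<le> v" "v \<le> n"
    by (rule unary_enc_nat)
  then show ?thesis using assms by simp
qed

section \<open>Acceptance of exactly the yes-instances\<close>

text \<open>The bound on \<open>n\<close> adds up the sizes of a solution: at most
  \<open>budget G\<close> deleted edges, \<open>target G\<close> covering vertices, and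
  \<open>2 m (2 m + 1)\<close> kept edges for \<open>m = target G\<close>. A padding of
  \<open>4 ^ n\<close> suffices for the branching and, as \<open>F\<close> has at most
  \<open>n\<close> edges, for the matchings.\<close>

lemma accept_iff:
  assumes G: "mmei_instance G" "\<forall>e\<in>edges G. weight G e = 1"
    and es: "distinct (map ends es)" "set (map ends es) = edges G"
    and x: "x = Br (Br vs (enc_list (map (enc_edge G) es))) (Br (enc_nat (budget G)) (enc_nat (target G)))"
    and n: "budget G + target G + 2 * target G * (2 * target G + 1) \<le> n"
  shows "accept (enc_unary (4 ^ n)) (enc_unary n) x \<longleftrightarrow> mmei_yes G"
proof -
  let ?b = "budget G" and ?m = "target G"
  have bm: "?b < n" "?m \<le> n" using n G(1) by (auto simp: mmei_instance_def)
  have E: "finite (edges G)" "\<forall>e\<in>edges G. card e = 2" "\<forall>e\<in>edges G. 1 \<le> cost G e"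
    using G(1) es(2)[symmetric] by (auto simp: mmei_instance_def)
  have inj: "inj_on ends (set es)" and des: "distinct es" using es(1) by (simp_all add: distinct_map)
  have one: "Br Leaf (enc_unary k) = enc_unary (Suc k)" for k
    by (simp add: enc_unary_def enc_list_def)
  have nil: "enc_list [] = Leaf" by (simp add: enc_list_def)
  have "accept (enc_unary (4 ^ n)) (enc_unary n) x \<longleftrightarrow>
    (\<exists>s\<in>set (paths (decide_edge n) es ([], [], [])).
      good (enc_unary (4 ^ n)) (enc_unary (Suc ?m)) (enc_state G n s))"
    using set_search_branch[of G "enc_unary n" n "enc_unary (4 ^ n)" es] bm
    unfolding accept_def x by (simp add: nil unary_enc_nat_exact list_of_Leaves one)
  also have "\<dots> \<longleftrightarrow> (\<exists>I U F. (I, U, F) \<in> set (paths (decide_edge n) es ([], [], [])) \<and>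
      sum_list (map (cost G \<circ> ends) I) \<le> ?b \<and>
      (\<forall>M. matching (ends ` set F) M \<longrightarrow> length U + card M \<le> ?m))"
  proof -
    have "good (enc_unary (4 ^ n)) (enc_unary (Suc ?m)) (enc_state G n (I, U, F)) \<longleftrightarrow>
      sum_list (map (cost G \<circ> ends) I) \<le> ?b \<and> (\<forall>M. matching (ends ` set F) M \<longrightarrow> length U + card M \<le> ?m)"
      if "(I, U, F) \<in> set (paths (decide_edge n) es ([], [], []))" for I U F
    proof (rule good_enc)
      have "length F \<le> n" using paths_decide_edge_sound[OF that] es(1) by simp
      then have "(2 :: nat) ^ length F \<le> 2 ^ n" by (rule power_increasing) simp
      also have "(2 :: nat) ^ n \<le> 4 ^ n" by (rule power_mono) simp_all
      finally show "2 ^ length F \<le> length (list_of (enc_unary (4 ^ n)))" by (simp add: list_of_Leaves)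
    qed
    then show ?thesis by (metis prod_cases3)
  qed
  also have "\<dots> \<longleftrightarrow> mmei_yes G"
  proof
    assume "\<exists>I U F. (I, U, F) \<in> set (paths (decide_edge n) es ([], [], [])) \<and>
      sum_list (map (cost G \<circ> ends) I) \<le> ?b \<and>
      (\<forall>M. matching (ends ` set F) M \<longrightarrow> length U + card M \<le> ?m)"
    then obtain I U F where IUF: "(I, U, F) \<in> set (paths (decide_edge n) es ([], [], []))"
      and cost: "sum_list (map (cost G \<circ> ends) I) \<le> ?b"
      and mat: "\<And>M. matching (ends ` set F) M \<Longrightarrow> length U + card M \<le> ?m" by blast
    have inv: "distinct (map ends I)" "set I \<subseteq> set es"
      "\<forall>e\<in>set es. e \<in> set I \<or> ends e \<inter> set U \<noteq> {} \<or> e \<in> set F"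
      using paths_decide_edge_sound[OF IUF] es(1) by auto
    let ?I = "ends ` set I"
    have "?I \<subseteq> edges G" using inv(2) es(2) by auto
    moreover have "sum (cost G) ?I \<le> ?b"
      using cost sum_list_distinct_conv_sum_set[OF inv(1), of "cost G"] by simp
    moreover have "nu (edges G - ?I) (weight G) \<le> ?m"
    proof -
      have "card M \<le> ?m" if "matching (edges G - ?I) M" for M
      proof (rule card_matching_le[OF _ _ _ _ that])
        show "e \<inter> set U \<noteq> {} \<or> e \<in> ends ` set F" if "e \<in> edges G - ?I" for e
        proof -
          have "e \<in> ends ` set es" using that es(2) by simp
          then obtain e' where "e = ends e'" "e' \<in> set es" by blast
          then show ?thesis using that inv(3) by blast
        qed
        show "card (set U) + card M \<le> ?m" if "matching (ends ` set F) M" for M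
          using mat[OF that] card_length[of U] by simp
      qed (use E in auto)
      then show ?thesis using E G(2) by (subst nu_le_iff) auto
    qed
    ultimately show "mmei_yes G" unfolding mmei_yes_def by blast
  next
    assume "mmei_yes G"
    then obtain I where I: "I \<subseteq> edges G" "sum (cost G) I \<le> ?b" "nu (edges G - I) (weight G) \<le> ?m"
      unfolding mmei_yes_def by blast
    have fin: "finite I" using I(1) E(1) finite_subset by blast
    have mat: "card M \<le> ?m" if "matching (edges G - I) M" for M
      using I(3) that E G(2) by (subst (asm) nu_le_iff) auto
    obtain U F where UF: "finite U" "F \<subseteq> edges G - I"
      "\<And>e. e \<in> edges G - I \<Longrightarrow> e \<inter> U \<noteq> {} \<or> e \<in> F"
      "card F \<le> 2 * ?m * (2 * ?m + 1)" "\<And>M. matching F M \<Longrightarrow> card U + card M \<le> ?m"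
      by (rule matching_bound_cover[of "edges G - I" ?m]) (use E mat in auto)
    \<comment> \<open>The empty matching of \<open>F\<close> bounds \<open>U\<close>.\<close>
    have cU: "card U \<le> ?m" using UF(5)[of "{}"] by (simp add: matching_def)
    have cI: "card I \<le> ?b"
    proof -
      \<comment> \<open>Costs are at least 1, so the budget also bounds the number of deleted
        edges.\<close>
      have "card I \<le> sum (cost G) I" unfolding card_eq_sum by (rule sum_mono) (use I(1) E(3) in auto)
      then show ?thesis using I(2) by simp
    qed
    have card_le: "card {e\<in>set es. ends e \<in> A} \<le> card A" if "finite A" for A
      by (rule card_inj_on_le[of ends]) (use inj that in \<open>auto intro: inj_on_subset\<close>)
    \<comment> \<open>Back from edges as sets to the pairs in the input list; \<open>ends\<close> is
      injective on them, so cardinalities do not grow.\<close>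
    let ?X = "{e\<in>set es. ends e \<in> I}" and ?Z = "{e\<in>set es. ends e \<in> F}"
    have finF: "finite F" using UF(2) E(1) finite_subset by blast
    have "card ?X + card U + card ?Z \<le> n"
      using card_le[OF fin] card_le[OF finF] cI cU UF(4) n by linarith
    moreover have "\<forall>e\<in>set es. e \<in> ?X \<or> ends e \<inter> U \<noteq> {} \<or> e \<in> ?Z"
      using UF(3) es(2) by auto
    ultimately obtain I' U' F' where p: "(I', U', F') \<in> set (paths (decide_edge n) es ([], [], []))"
      "set I' \<subseteq> ?X" "set U' \<subseteq> U" "set F' \<subseteq> ?Z" "distinct I'" "distinct U'"
      using paths_decide_edge_complete[of ?X U ?Z n "[]" "[]" "[]" es] UF(1) des by auto
    have "distinct (map ends I')"
      unfolding distinct_map using p(2,5) inj by (auto intro: inj_on_subset)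
    then have "sum_list (map (cost G \<circ> ends) I') = sum (cost G) (ends ` set I')"
      using sum_list_distinct_conv_sum_set[of "map ends I'" "cost G"] by simp
    also have "\<dots> \<le> sum (cost G) I"
      by (rule sum_mono2) (use fin p(2) in auto)
    finally have "sum_list (map (cost G \<circ> ends) I') \<le> ?b" using I(2) by simp
    moreover have "length U' + card M \<le> ?m" if "matching (ends ` set F') M" for M
    proof -
      have "matching F M" using that p(4) by (auto simp: matching_def)
      moreover have "length U' \<le> card U" by (rule distinct_length_le) (use p UF(1) in auto)
      ultimately show ?thesis using UF(5) by fastforce
    qed
    ultimately show "\<exists>I U F. (I, U, F) \<in> set (paths (decide_edge n) es ([], [], [])) \<and>
      sum_list (map (cost G \<circ> ends) I) \<le> ?b \<and>
      (\<forall>M. matching (ends ` set F) M \<longrightarrow> length U + card M \<le> ?m)"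
      using p(1) by blast
  qed
  finally show ?thesis .
qed

section \<open>Running time\<close>

lemma cat_unary: "cat (\<lambda>_. enc_unary a) (enc_unary b) = enc_unary (b * a)"
proof (rule list_of_eqI)
  have "concat (replicate b (replicate a Leaf)) = replicate (b * a) Leaf"
    by (induction b) (simp_all add: replicate_add)
  then show "list_of (cat (\<lambda>_. enc_unary a) (enc_unary b)) = list_of (enc_unary (b * a))"
    by (simp add: list_of_cat list_of_Leaves)
qed

lemma ptime_cat_const:
  assumes "ptime F" "ptime G"
  shows "ptime (\<lambda>x. cat (\<lambda>_. F x) (G x))"
  by (rule ptime_cat[where f = "\<lambda>x _. F x"]) (intro ptime_compose[OF assms(1)] ptime_intros assms)+

lemma ptime_unary_const: "ptime (\<lambda>x. enc_unary c)"
proof (induction c)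
  case 0
  then show ?case by (simp add: enc_unary_def enc_list_def ptime_intros)
next
  case (Suc c)
  have "(\<lambda>x :: bt. enc_unary (Suc c)) = (\<lambda>x. Br Leaf (enc_unary c))"
    by (simp add: enc_unary_def enc_list_def)
  then show ?case using Suc by (simp only:) (intro ptime_intros)
qed

lemma outputs_comp_in:
  assumes "comp_in F T"
  obtains p where "\<And>x. \<exists>t\<le>T x. outputs p x t (F x)"
proof -
  obtain p where p: "comp_at 0 0 p F T" using assms by (rule comp_inE)
  have "\<exists>t\<le>T x. outputs p x t (F x)" for x
  proof -
    obtain s where "runs p (init x) (T (init x 0)) s" "s 0 = F (init x 0)"
      using p by (rule comp_atE)
    then show ?thesis by (auto simp: runs_def outputs_def init_def)
  qed
  then show ?thesis by (rule that)
qed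

text \<open>The exponent is doubled to use base 2: unary products give
  \<open>2 * ((k ^ 4 + 1) * d)\<close>, where \<open>Br Leaf\<close> contributes the 1, and
  \<open>pow2\<close> does the rest.\<close>

lemma computable_exp: "computable (\<lambda>k. 4 ^ ((k ^ 4 + 1) * d))"
proof -
  define A where "A = (\<lambda>x. cat (\<lambda>_. enc_unary (2 * d)) (Br Leaf (cat (\<lambda>_. x) (cat (\<lambda>_. x) (cat (\<lambda>_. x) x)))))"
  have "ptime A" unfolding A_def by (intro ptime_cat_const ptime_unary_const ptime_intros)
  then obtain T where "comp_in A T" by (rule ptime_inE)
  moreover obtain U where "comp_in pow2 U" using ptime_in_pow2 by (rule ptime_inE)
  ultimately have "comp_in (\<lambda>x. pow2 (A x)) (\<lambda>x. T x + U (A x))" by (rule comp_in_compose)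
  then obtain p where p: "\<And>x. \<exists>t\<le>T x + U (A x). outputs p x t (pow2 (A x))"
    by (rule outputs_comp_in) blast
  have "Br Leaf (enc_unary k) = enc_unary (Suc k)" for k
    by (simp add: enc_unary_def enc_list_def)
  then have "A (enc_unary k) = enc_unary (2 * ((k ^ 4 + 1) * d))" for k
    by (simp add: A_def cat_unary power4_eq_xxxx algebra_simps)
  moreover have "(2 :: nat) ^ (2 * j) = 4 ^ j" for j by (simp add: power_mult)
  ultimately have "pow2 (A (enc_unary k)) = enc_unary (4 ^ ((k ^ 4 + 1) * d))" for k
    unfolding pow2_eq by (simp only: list_of_Leaves length_replicate)
  then show ?thesis unfolding computable_def using p by metis
qed

section \<open>The complete algorithm and its cost\<close>

text \<open>Read off from the numbers of digits: \<open>2 ^ length (bits n)\<close> lies between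
  \<open>n + 1\<close> and \<open>2 * n\<close> for positive \<open>n\<close>. Listing the digits of
  budget and target twice squares the product of these powers, which exceeds the fuel needed and
  stays below a polynomial in the parameter.\<close>

definition fuel :: "bt \<Rightarrow> bt" where
  "fuel x = pow2 (push (left (right x)) (push (left (right x)) (push (right (right x)) (right (right x)))))"

text \<open>Doubling the fuel list before \<open>pow2\<close> gives a padding of length
  \<open>4 ^ n\<close> for fuel \<open>n\<close>.\<close>

definition solve :: "bt \<Rightarrow> bt" where
  "solve x = enc_bool (accept (pow2 (push (fuel x) (fuel x))) (fuel x) x)"

lemma length_fuel: "length (list_of (fuel x)) =
    (2 ^ length (list_of (left (right x))) * 2 ^ length (list_of (right (right x)))) ^ 2"
  by (simp add: fuel_def pow2_eq list_of_Leaves list_of_push power_add power2_eq_square)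

text \<open>The measure contains the length of the padding. Both lists have polynomial size in it,
  and \<open>accept\<close> is polynomial in these lists and the input.\<close>

lemma ptime_in_solve: "ptime_in (\<lambda>x. nodes x + 4 ^ length (list_of (fuel x))) solve"
proof -
  let ?Z = "\<lambda>x. nodes x + 4 ^ length (list_of (fuel x))"
  define A where "A = (\<lambda>x. push (left (right x)) (push (left (right x)) (push (right (right x)) (right (right x)))))"
  have id: "ptime_in ?Z (\<lambda>x. x)"
    by (rule ptime_inI[OF poly_in_mono[OF poly_in_self] poly_in_const comp_in_id]) simp
  have "ptime A" unfolding A_def by (intro ptime_push ptime_intros)
  then have A: "ptime_in ?Z A" using id by (rule ptime_compose)
  have fuel: "fuel x = enc_unary (2 ^ length (list_of (A x)))" for x
    by (simp add: fuel_def A_def pow2_eq)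
  have "2 ^ length (list_of (A x)) \<le> ?Z x" for x
  proof -
    have "k < 4 ^ k" for k :: nat by (induction k) simp_all
    from this[of "length (list_of (fuel x))"] show ?thesis by (simp add: fuel list_of_Leaves)
  qed
  then have "poly_in ?Z (\<lambda>x. nodes (A x) + 2 ^ length (list_of (A x)))"
    by (intro poly_in_add ptime_inD A poly_in_mono[OF poly_in_self])
  then have "ptime_in ?Z (\<lambda>x. pow2 (A x))" by (rule ptime_in_compose[OF ptime_in_pow2 A])
  moreover have "(\<lambda>x. pow2 (A x)) = fuel" by (simp add: fuel_def A_def fun_eq_iff)
  ultimately have F: "ptime_in ?Z fuel" by (simp only:)
  have P: "ptime_in ?Z (\<lambda>x. push (fuel x) (fuel x))"
    by (rule ptime_compose[OF _ F]) (intro ptime_push ptime_intros)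
  have "poly_in ?Z (\<lambda>x. nodes (push (fuel x) (fuel x)) + 2 ^ length (list_of (push (fuel x) (fuel x))))"
    by (intro poly_in_add ptime_inD P poly_in_mono[OF poly_in_self])
      (simp add: list_of_push mult_2[symmetric] power_mult)
  then have "ptime_in ?Z (\<lambda>x. pow2 (push (fuel x) (fuel x)))"
    by (rule ptime_in_compose[OF ptime_in_pow2 P])
  then have "ptime_in ?Z (\<lambda>x. Br (pow2 (push (fuel x) (fuel x))) (Br (fuel x) x))"
    by (intro ptime_in_Br F id)
  moreover have "pdec (\<lambda>y. accept (left y) (left (right y)) (right (right y)))"
    by (intro pdec_accept ptime_intros)
  ultimately show ?thesis
    using ptime_compose by (fastforce simp: solve_def[abs_def])
qed

text \<open>Halving removes exactly one digit, and rounding down loses at most 1, which the strict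
  inequality tolerates.\<close>

lemma length_bits: "0 < n \<Longrightarrow> n < 2 ^ length (bits n) \<and> 2 ^ length (bits n) \<le> 2 * n"
proof (induction n rule: bits.induct)
  case (2 n)
  show ?case
  proof (cases "Suc n div 2 = 0")
    case True
    then have "n = 0" by simp
    then show ?thesis by simp
  next
    case False
    then have "Suc n div 2 < 2 ^ length (bits (Suc n div 2))" "2 ^ length (bits (Suc n div 2)) \<le> 2 * (Suc n div 2)"
      using 2 by simp_all
    moreover have "length (bits (Suc n)) = Suc (length (bits (Suc n div 2)))" by simp
    moreover have "2 * (Suc n div 2) \<le> Suc n" "Suc n \<le> 2 * (Suc n div 2) + 1" by presburger+
    moreover have "k < 2 * l \<and> 2 * l \<le> 2 * k"
      if "h < l" "l \<le> 2 * h" "2 * h \<le> k" "k \<le> 2 * h + 1" for h k l :: nat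
      using that by linarith
    ultimately show ?thesis by (simp only: power_Suc)
  qed
qed simp

theorem theorem5:
  "fpt {G. mmei_instance G \<and> (\<forall>e\<in>edges G. weight G e = 1)} mmei_enc mmei_yes
     (\<lambda>G. budget G + target G)"
proof -
  obtain T where T: "poly_in (\<lambda>x. nodes x + 4 ^ length (list_of (fuel x))) T" "comp_in solve T"
    using ptime_in_solve by (rule ptime_inE)
  obtain d where d: "\<And>x. T x \<le> (nodes x + 4 ^ length (list_of (fuel x)) + 2) ^ d"
    using T(1) unfolding poly_in_def by blast
  obtain p where p: "\<And>x. \<exists>t\<le>T x. outputs p x t (solve x)"
    using T(2) by (rule outputs_comp_in) blast
  have "\<exists>t y. outputs p x t y \<and> t \<le> 4 ^ (((budget G + target G) ^ 4 + 1) * d) * nodes x ^ d \<and>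
      (y \<noteq> Leaf \<longleftrightarrow> mmei_yes G)"
    if G: "mmei_instance G" "\<forall>e\<in>edges G. weight G e = 1" and enc: "mmei_enc x G" for G x
  proof -
    let ?b = "budget G" and ?m = "target G"
    obtain vs es where es: "distinct (map ends es)" "set (map ends es) = edges G"
      and x: "x = Br (Br vs (enc_list (map (enc_edge G) es))) (Br (enc_nat ?b) (enc_nat ?m))"
      using enc unfolding mmei_enc_def ends_def by blast
    define n where "n = length (list_of (fuel x))"
    let ?B = "2 ^ length (bits ?b) :: nat" and ?M = "2 ^ length (bits ?m) :: nat"
    have n: "n = (?B * ?M) ^ 2"
      unfolding n_def length_fuel by (simp add: x enc_nat_def)
    have pos: "1 \<le> ?b" "1 \<le> ?m" using G(1) by (auto simp: mmei_instance_def)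
    then have B: "?b + 1 \<le> ?B" "?B \<le> 2 * ?b" and M: "?m + 1 \<le> ?M" "?M \<le> 2 * ?m"
      using length_bits[of ?b] length_bits[of ?m] by auto
    have "?b + ?m + 2 * ?m * (2 * ?m + 1) \<le> ((?b + 1) * (?m + 1)) ^ 2"
    proof -
      \<comment> \<open>Written in the predecessors of budget and target, the inequality holds
        coefficient by coefficient.\<close>
      obtain b m where "?b = Suc b" "?m = Suc m" using pos by (metis Suc_le_D One_nat_def)
      then show ?thesis by (simp add: power2_eq_square algebra_simps)
    qed
    also have "\<dots> \<le> n" unfolding n by (intro power_mono mult_mono B M) simp_all
    finally have lower: "?b + ?m + 2 * ?m * (2 * ?m + 1) \<le> n" .
    have "?B * ?M \<le> (2 * ?b) * (2 * ?m)" by (intro mult_mono B M) simp_all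
    also have "\<dots> \<le> (?b + ?m) ^ 2"
    proof -
      \<comment> \<open>The inequality \<open>4 b m <= (b + m)^2\<close>, over the integers because
        it rests on the square of a difference.\<close>
      have "(2 * int ?b) * (2 * int ?m) \<le> (int ?b + int ?m) ^ 2"
        using zero_le_power2[of "int ?b - int ?m"] by (simp add: power2_eq_square algebra_simps)
      then have "int ((2 * ?b) * (2 * ?m)) \<le> int ((?b + ?m) ^ 2)" by simp
      then show ?thesis by (simp only: of_nat_le_iff)
    qed
    finally have "n \<le> ((?b + ?m) ^ 2) ^ 2" unfolding n by (rule power_mono) simp
    then have upper: "n \<le> (?b + ?m) ^ 4" by (simp flip: power_mult)
    have fuel: "fuel x = enc_unary n"
      unfolding n_def by (simp add: fuel_def pow2_eq list_of_Leaves)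
    have "pow2 (push (fuel x) (fuel x)) = enc_unary (4 ^ n)"
      unfolding pow2_eq by (simp add: fuel list_of_push list_of_Leaves mult_2[symmetric] power_mult)
    then have yes: "solve x \<noteq> Leaf \<longleftrightarrow> mmei_yes G"
      using accept_iff[OF G es x lower] unfolding solve_def fuel by (simp add: enc_bool_def)
    obtain t where t: "t \<le> T x" "outputs p x t (solve x)" using p by blast
    \<comment> \<open>The sum is turned into a product so that its power splits into a factor
      depending on the parameter and a power of the input size.\<close>
    have "nodes x + 4 ^ n + 2 \<le> 4 ^ (n + 1) * nodes x"
    proof -
      have "N + q + 2 \<le> q * 4 * N" if "1 \<le> q" "1 \<le> N" for q N :: nat
      proof -
        obtain r K where "q = r + 1" "N = K + 1" using \<open>1 \<le> q\<close> \<open>1 \<le> N\<close> by (metis le_add_diff_inverse2)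
        then show ?thesis by (simp add: algebra_simps)
      qed
      from this[of "4 ^ n" "nodes x"] show ?thesis using nodes_pos[of x] by simp
    qed
    also have "\<dots> \<le> 4 ^ ((?b + ?m) ^ 4 + 1) * nodes x"
      by (intro mult_right_mono power_increasing) (use upper in simp_all)
    finally have "(nodes x + 4 ^ n + 2) ^ d \<le> (4 ^ ((?b + ?m) ^ 4 + 1) * nodes x) ^ d"
      by (rule power_mono) simp
    then have "t \<le> 4 ^ (((?b + ?m) ^ 4 + 1) * d) * nodes x ^ d"
      using t(1) d[of x] unfolding n_def[symmetric] power_mult_distrib power_mult by linarith
    then show ?thesis using t(2) yes by blast
  qed
  then show ?thesis
    unfolding fpt_def using computable_exp[of d]
    by (intro exI[of _ p] exI[of _ "\<lambda>k. 4 ^ ((k ^ 4 + 1) * d)"] exI[of _ d]) blast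
qed

end
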